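(* Let $D$ be a planar domain contained in the unit disk whose boundary $\partial D$ is a set of closed polygonal contours: an outer boundary, and potentially several internal boundaries representing holes. The boundary is composed of directed linear edges $e=(A,B)$, ordered counter-clockwise for the external contour and clockwise for the internal holes. Let $n\ge 0$ and $m$ be integers with $|m|\le n$ and $n-|m|$ even. Then the Zernike moment $$Z_n^m=\iint_D (V_n^m)^{\ast}(\boldsymbol{x})\,d\boldsymbol{x}$$ is the sum of contributions of the edges, $$Z_n^m=\sum_{e=(A,B)\in\partial D} Z_n^m(e),\qquad Z_n^m(e)=\epsilon_{AB}\iint_{\sigma_{AB}}(V_n^m)^{\ast}(\boldsymbol{x})\,d\boldsymbol{x},$$ and each contribution is given by the one-dimensional integrals $$Z_n^m(e)=\epsilon_{AB}\int_{\theta_A}^{\theta_B}Q_n^m(r(\theta))\,e^{-im\theta}\,d\theta=\epsilon_{AB}\int_{-1}^{1}A_n^m(t)\,dt .$$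
   Context: The star denotes complex conjugation. For integers $n\ge 0$ and $m$ with $|m|\le n$ and $n-|m|$ even, the Zernike radial polynomial is $$R_n^{m}(r)=R_n^{|m|}(r)=\sum_{k=0}^{(n-|m|)/2}(-1)^k\frac{(n-k)!}{k!\left(\frac{n+|m|}{2}-k\right)!\left(\frac{n-|m|}{2}-k\right)!}\,r^{n-2k},$$ and the Zernike basis function on the unit disk is, in polar coordinates, $V_n^m(r,\theta)=\sqrt{\frac{n+1}{\pi}}\,R_n^m(r)\,e^{im\theta}$. The radial primitive is $Q_n^m(r)=\int_0^r s\,R_n^m(s)\,ds$. For a directed edge $e=(A,B)$ with $A=(x_A,y_A)$, $B=(x_B,y_B)$, $\sigma_{AB}=(O,A,B)$ is the triangle formed with the origin $O$, and the orientation factor is the sign of its signed area, $\epsilon_{AB}=\mathrm{sign}\left(\tfrac12(x_Ay_B-y_Ax_B)\right)$. The angles $\theta_A,\theta_B$ are the polar angles of $A$ and $B$, and $r(\theta)$ is the distance from the origin to the point where the ray at angle $\theta$ meets the edge $e$. For $t\in[-1,1]$ the edge is parameterized by $x(t)=\frac{(1-t)x_A+(1+t)x_B}{2}$, $y(t)=\frac{(1-t)y_A+(1+t)y_B}{2}$, with $r(t)=\sqrt{x(t)^2+y(t)^2}$ and $\theta(t)$ the polar angle of $(x(t),y(t))$. With $C=(x_Ay_B-y_Ax_B)/2$ (a signed quantity), one sets $$A_n^m(t)=C\,\frac{Q_n^m(r(t))\,e^{-im\theta(t)}}{r(t)^2}.$$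
   Formalization: Both one-dimensional integrals get the missing factor sqrt((n+1)/pi); since they are already signed, the extra epsilon_AB is dropped, or kept with the unsigned integrals (|C| for C). Polar angles are chosen with |theta_B - theta_A| <= pi. *)

theory Defs
  imports "HOL-Complex_Analysis.Complex_Analysis"
begin

text \<open>The plane is the type \<^typ>\<open>complex\<close>, the origin is \<open>0\<close>, and area integrals are
  integrals with respect to Lebesgue measure on \<^typ>\<open>complex\<close>.\<close>

subsection \<open>Zernike functions\<close>

definition zernike_R :: "nat \<Rightarrow> int \<Rightarrow> real \<Rightarrow> real" where
  "zernike_R n m r =
     (\<Sum>k = 0..(n - nat \<bar>m\<bar>) div 2.
        (-1) ^ k * fact (n - k)
        / (fact k * fact ((n + nat \<bar>m\<bar>) div 2 - k) * fact ((n - nat \<bar>m\<bar>) div 2 - k))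
        * r ^ (n - 2 * k))"

definition zernike_norm :: "nat \<Rightarrow> real" where
  "zernike_norm n = sqrt ((real n + 1) / pi)"

text \<open>The convention \<open>Arg 0 = 0\<close> is harmless: a point has measure zero.\<close>

definition zernike_V :: "nat \<Rightarrow> int \<Rightarrow> complex \<Rightarrow> complex" where
  "zernike_V n m z =
     of_real (zernike_norm n) * of_real (zernike_R n m (cmod z)) * cis (of_int m * Arg z)"

definition zernike_Q :: "nat \<Rightarrow> int \<Rightarrow> real \<Rightarrow> real" where
  "zernike_Q n m r = (LBINT s=ereal 0..ereal r. s * zernike_R n m s)"

definition zernike_moment :: "nat \<Rightarrow> int \<Rightarrow> complex set \<Rightarrow> complex" where
  "zernike_moment n m D = (LINT z:D|lborel. cnj (zernike_V n m z))"

subsection \<open>Contributions of a directed edge\<close>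

definition signed_area :: "complex \<Rightarrow> complex \<Rightarrow> real" where
  "signed_area A B = (Re A * Im B - Im A * Re B) / 2"

definition orient :: "complex \<Rightarrow> complex \<Rightarrow> real" where
  "orient A B = sgn (signed_area A B)"

definition edge_moment :: "nat \<Rightarrow> int \<Rightarrow> complex \<Rightarrow> complex \<Rightarrow> complex" where
  "edge_moment n m A B =
     of_real (orient A B) * (LINT z:convex hull {0, A, B}|lborel. cnj (zernike_V n m z))"

text \<open>The hit point of the ray is unique when \<open>0, A, B\<close> are not collinear. For collinear
  \<open>0, A, B\<close> it is unique (the origin) for every angle strictly between the polar angles
  of \<open>A\<close> and \<open>B\<close>.\<close>

definition edge_radius :: "complex \<Rightarrow> complex \<Rightarrow> real \<Rightarrow> real" where
  "edge_radius A B \<theta> = (THE r. 0 \<le> r \<and> of_real r * cis \<theta> \<in> closed_segment A B)"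

definition angular_integrand :: "nat \<Rightarrow> int \<Rightarrow> complex \<Rightarrow> complex \<Rightarrow> real \<Rightarrow> complex" where
  "angular_integrand n m A B \<theta> =
     of_real (zernike_Q n m (edge_radius A B \<theta>)) * cis (- of_int m * \<theta>)"

definition edge_point :: "complex \<Rightarrow> complex \<Rightarrow> real \<Rightarrow> complex" where
  "edge_point A B t = ((1 - t) / 2) *\<^sub>R A + ((1 + t) / 2) *\<^sub>R B"

text \<open>If the edge passes through the origin then \<open>signed_area A B = 0\<close>, so the division by zero at
  that parameter is immaterial. As \<open>signed_area\<close> is signed, \<open>zernike_A\<close> already carries the
  orientation of the edge, and \<open>orient A B * signed_area A B = \<bar>signed_area A B\<bar>\<close>. The factor
  \<open>zernike_norm n\<close> is part of neither \<open>zernike_A\<close> nor \<open>angular_integrand\<close>.\<close>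

definition zernike_A :: "nat \<Rightarrow> int \<Rightarrow> complex \<Rightarrow> complex \<Rightarrow> real \<Rightarrow> complex" where
  "zernike_A n m A B t =
     of_real (signed_area A B)
     * (of_real (zernike_Q n m (cmod (edge_point A B t)))
        * cis (- of_int m * Arg (edge_point A B t))
        / of_real ((cmod (edge_point A B t))\<^sup>2))"

definition polar_angle :: "complex \<Rightarrow> real \<Rightarrow> bool" where
  "polar_angle z \<theta> \<longleftrightarrow> z = of_real (cmod z) * cis \<theta>"

subsection \<open>Polygonal contours and domains\<close>

text \<open>A contour is the list of its vertices in the order of traversal, without repeating the
  first vertex at the end.\<close>

fun polygonal_path :: "complex list \<Rightarrow> real \<Rightarrow> complex" where
  "polygonal_path [] = linepath 0 0"
| "polygonal_path [a] = linepath a a"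
| "polygonal_path [a, b] = linepath a b"
| "polygonal_path (a # b # c # vs) = linepath a b +++ polygonal_path (b # c # vs)"

definition contour_path :: "complex list \<Rightarrow> real \<Rightarrow> complex" where
  "contour_path vs = polygonal_path (vs @ [hd vs])"

definition contour_edges :: "complex list \<Rightarrow> (complex \<times> complex) list" where
  "contour_edges vs = zip vs (rotate1 vs)"

abbreviation contour_image :: "complex list \<Rightarrow> complex set" where
  "contour_image vs \<equiv> path_image (contour_path vs)"

definition simple_contour :: "complex list \<Rightarrow> bool" where
  "simple_contour vs \<longleftrightarrow> 3 \<le> length vs \<and> simple_path (contour_path vs)"

definition counterclockwise :: "complex list \<Rightarrow> bool" where
  "counterclockwise vs \<longleftrightarrow>
     (\<forall>z \<in> inside (contour_image vs). winding_number (contour_path vs) z = 1)"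

definition clockwise :: "complex list \<Rightarrow> bool" where
  "clockwise vs \<longleftrightarrow>
     (\<forall>z \<in> inside (contour_image vs). winding_number (contour_path vs) z = -1)"

text \<open>Contours may touch one another in isolated points: they need not be disjoint, but all of
  them must lie in the boundary of \<open>D\<close>.\<close>

definition polygonal_domain ::
    "complex set \<Rightarrow> complex list \<Rightarrow> complex list list \<Rightarrow> bool" where
  "polygonal_domain D outer holes \<longleftrightarrow>
     simple_contour outer \<and> counterclockwise outer \<and>
     (\<forall>h \<in> set holes. simple_contour h \<and> clockwise h) \<and>
     (\<forall>i j. i < j \<and> j < length holes \<longrightarrow>
        inside (contour_image (holes ! i)) \<inter> inside (contour_image (holes ! j)) = {}) \<and>
     open D \<and> connected D \<and>
     D = inside (contour_image outer) \<inter> (\<Inter>h \<in> set holes. outside (contour_image h)) \<and>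
     frontier D = contour_image outer \<union> (\<Union>h \<in> set holes. contour_image h)"

definition boundary_edges ::
    "complex list \<Rightarrow> complex list list \<Rightarrow> (complex \<times> complex) list" where
  "boundary_edges outer holes = concat (map contour_edges (outer # holes))"

end

theory Submission
  imports Defs
begin

text \<open>Each closed polygonal contour winds around a generic point \<open>z\<close> as often as the signed sum of
  the triangles \<open>(0, A, B)\<close> over its edges covers \<open>z\<close>: the winding number of an edge is that of
  its triangle up to terms for the sides at the origin, which cancel around the contour. By
  orientation, the winding numbers of all contours add up to the indicator function of the domain,
  so the area integral splits into triangle integrals. In a triangle, the coordinates
  \<open>z = s ((1 - \<tau>) A + \<tau> B)\<close> with area element \<open>2 \<bar>C\<bar> s ds d\<tau>\<close> separate the radial integral, which
  gives \<open>Q / r\<^sup>2\<close>; the angular form follows from \<open>d\<theta>/dt = C / r\<^sup>2\<close> along the edge.\<close>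

subsection \<open>Integration over a triangle with a vertex at the origin\<close>

text \<open>No form of Green's theorem is used. The contours enter only through winding numbers,
  which give an identity of indicator functions off finitely many segments; integrating it does the
  rest. Orientation is the delicate point. Three things carry the sign of an edge:
  \<open>orient A B\<close>, the constant C = \<open>signed_area A B\<close>, and the order of the
  angular limits. The sign may enter a formula only once, so each formula is proved in two readings:
  signed without \<open>orient\<close>, or with \<open>orient\<close> in front of an unsigned
  integral, taken over the interval between the angles or with weight |C|. Polar angles are
  determined only up to multiples of 2 pi; bounding their difference by pi selects lifts between
  which the edge is seen from the origin. An edge on a line through the origin contributes nothing,
  but needs its own argument, since there the equation of the line no longer determines the hit
  radius.\<close>

lemma lborel_complex_eq_distr:
  "(lborel :: complex measure) = distr (lborel \<Otimes>\<^sub>M lborel) borel (\<lambda>(x, y). Complex x y)"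
\<comment> \<open>Lebesgue measure is determined by its values on boxes, and a box in the plane is a
  product of two intervals. This makes area integrals iterated integrals.\<close>
proof (rule lborel_eqI)
  have [measurable]: "(\<lambda>(x, y). Complex x y) \<in> borel_measurable (lborel \<Otimes>\<^sub>M lborel)"
    by (simp add: borel_measurable_complex_iff case_prod_beta' cong: measurable_cong_sets)
  fix l u :: complex
  assume le: "\<And>b. b \<in> Basis \<Longrightarrow> l \<bullet> b \<le> u \<bullet> b"
  have le': "Re l \<le> Re u" "Im l \<le> Im u"
    using le[of 1] le[of \<i>] by (auto simp: Basis_complex_def inner_complex_def)
  have "(\<lambda>(x, y). Complex x y) -` box l u \<inter> space (lborel \<Otimes>\<^sub>M lborel) =
      {Re l<..<Re u} \<times> {Im l<..<Im u}"
    by (auto simp: box_def Basis_complex_def inner_complex_def space_pair_measure)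
  then have "emeasure (distr (lborel \<Otimes>\<^sub>M lborel) borel (\<lambda>(x, y). Complex x y)) (box l u) =
      emeasure (lborel \<Otimes>\<^sub>M lborel) ({Re l<..<Re u} \<times> {Im l<..<Im u})"
    by (simp add: emeasure_distr)
  also have "\<dots> = (\<Prod>b\<in>Basis. (u - l) \<bullet> b)"
    using le' by (simp add: lborel.emeasure_pair_measure_Times Basis_complex_def inner_complex_def
        ennreal_mult)
  finally show "emeasure (distr (lborel \<Otimes>\<^sub>M lborel) borel (\<lambda>(x, y). Complex x y)) (box l u) =
      (\<Prod>b\<in>Basis. (u - l) \<bullet> b)" .
qed simp

lemma borel_measurable_Complex [measurable (raw)]:
  "f \<in> borel_measurable M \<Longrightarrow> g \<in> borel_measurable M \<Longrightarrow>
    (\<lambda>x. Complex (f x) (g x)) \<in> borel_measurable M"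
  by (simp add: borel_measurable_complex_iff)

lemma nn_integral_lborel_complex:
  assumes [measurable]: "g \<in> borel_measurable borel"
  shows "(\<integral>\<^sup>+z. g z \<partial>lborel) = (\<integral>\<^sup>+x. \<integral>\<^sup>+y. g (Complex x y) \<partial>lborel \<partial>lborel)"
proof -
  have "(\<integral>\<^sup>+z. g z \<partial>lborel) = (\<integral>\<^sup>+p. g (Complex (fst p) (snd p)) \<partial>(lborel \<Otimes>\<^sub>M lborel))"
    by (subst lborel_complex_eq_distr, subst nn_integral_distr) (auto simp: case_prod_beta')
  also have "\<dots> = (\<integral>\<^sup>+x. \<integral>\<^sup>+y. g (Complex x y) \<partial>lborel \<partial>lborel)"
    by (subst lborel.nn_integral_fst[symmetric]) auto
  finally show ?thesis .
qed

text \<open>The linear map is factored into two one-dimensional affine substitutions: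
  \<open>y = c / a * x + e * v\<close> with \<open>x\<close> fixed, then
  \<open>x = b * v + a * u\<close> with \<open>v\<close> fixed. The factors |e| and |a| multiply to
  the absolute determinant; \<open>a\<close> is the pivot of this elimination.\<close>

lemma nn_integral_linear_coordinates_aux:
  fixes a b c d :: real
  assumes [measurable]: "g \<in> borel_measurable borel"
    and det: "a * d - b * c \<noteq> 0" and a: "a \<noteq> 0"
  shows "(\<integral>\<^sup>+z. g z \<partial>lborel) = ennreal \<bar>a * d - b * c\<bar> *
    (\<integral>\<^sup>+v. \<integral>\<^sup>+u. g (Complex (u * a + v * b) (u * c + v * d)) \<partial>lborel \<partial>lborel)"
proof -
  define e where "e = (a * d - b * c) / a"
  have e: "e \<noteq> 0" using det a by (simp add: e_def)
  have "(\<integral>\<^sup>+z. g z \<partial>lborel) = (\<integral>\<^sup>+x. \<integral>\<^sup>+y. g (Complex x y) \<partial>lborel \<partial>lborel)"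
    by (rule nn_integral_lborel_complex) fact
  also have "\<dots> = (\<integral>\<^sup>+x. ennreal \<bar>e\<bar> * (\<integral>\<^sup>+v. g (Complex x (c / a * x + e * v)) \<partial>lborel) \<partial>lborel)"
    by (rule nn_integral_cong, rule nn_integral_real_affine) (use e in auto)
  also have "\<dots> = ennreal \<bar>e\<bar> * (\<integral>\<^sup>+x. \<integral>\<^sup>+v. g (Complex x (c / a * x + e * v)) \<partial>lborel \<partial>lborel)"
    by (rule nn_integral_cmult) measurable
  also have "(\<integral>\<^sup>+x. \<integral>\<^sup>+v. g (Complex x (c / a * x + e * v)) \<partial>lborel \<partial>lborel) =
      (\<integral>\<^sup>+v. \<integral>\<^sup>+x. g (Complex x (c / a * x + e * v)) \<partial>lborel \<partial>lborel)"
    by (rule lborel_pair.Fubini') measurable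
  also have "\<dots> = (\<integral>\<^sup>+v. ennreal \<bar>a\<bar> *
      (\<integral>\<^sup>+u. g (Complex (b * v + a * u) (c / a * (b * v + a * u) + e * v)) \<partial>lborel) \<partial>lborel)"
    by (rule nn_integral_cong, rule nn_integral_real_affine) (use a in auto)
  also have "\<dots> = ennreal \<bar>a\<bar> *
      (\<integral>\<^sup>+v. \<integral>\<^sup>+u. g (Complex (b * v + a * u) (c / a * (b * v + a * u) + e * v)) \<partial>lborel \<partial>lborel)"
    by (rule nn_integral_cmult) measurable
  also have "(\<lambda>v u. g (Complex (b * v + a * u) (c / a * (b * v + a * u) + e * v))) =
      (\<lambda>v u. g (Complex (u * a + v * b) (u * c + v * d)))"
    using a by (intro ext arg_cong[where f = g]) (simp add: e_def field_simps)
  finally have "(\<integral>\<^sup>+z. g z \<partial>lborel) = ennreal \<bar>e\<bar> * (ennreal \<bar>a\<bar> *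
    (\<integral>\<^sup>+v. \<integral>\<^sup>+u. g (Complex (u * a + v * b) (u * c + v * d)) \<partial>lborel \<partial>lborel))" .
  moreover have "ennreal \<bar>e\<bar> * ennreal \<bar>a\<bar> = ennreal \<bar>a * d - b * c\<bar>"
    using a by (subst ennreal_mult'[symmetric]) (auto simp: e_def)
  ultimately show ?thesis
    by (simp only: mult.assoc[symmetric])
qed

text \<open>If \<open>Re A\<close> vanishes, \<open>Re B\<close> serves as the pivot, and Tonelli's
  theorem restores the order of integration. The factor is the area of the parallelogram spanned by
  \<open>A\<close> and \<open>B\<close>.\<close>

lemma nn_integral_linear_coordinates:
  assumes [measurable]: "g \<in> borel_measurable borel" and det: "signed_area A B \<noteq> 0"
  shows "(\<integral>\<^sup>+z. g z \<partial>lborel) = ennreal (2 * \<bar>signed_area A B\<bar>) *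
    (\<integral>\<^sup>+v. \<integral>\<^sup>+u. g (u *\<^sub>R A + v *\<^sub>R B) \<partial>lborel \<partial>lborel)"
proof (cases "Re A = 0")
  case False
  have [simp]: "Complex (u * Re A + v * Re B) (u * Im A + v * Im B) = u *\<^sub>R A + v *\<^sub>R B" for u v
    by (simp add: complex_eq_iff)
  show ?thesis
    using nn_integral_linear_coordinates_aux[OF assms(1), of "Re A" "Im B" "Re B" "Im A"] det False
    by (simp add: signed_area_def mult.commute)
next
  case True
  then have b: "Re B \<noteq> 0" using det by (auto simp: signed_area_def)
  have [simp]: "Complex (v * Re B + u * Re A) (v * Im B + u * Im A) = u *\<^sub>R A + v *\<^sub>R B" for u v
    by (simp add: complex_eq_iff)
  have "(\<integral>\<^sup>+v. \<integral>\<^sup>+u. g (u *\<^sub>R A + v *\<^sub>R B) \<partial>lborel \<partial>lborel) =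
      (\<integral>\<^sup>+u. \<integral>\<^sup>+v. g (u *\<^sub>R A + v *\<^sub>R B) \<partial>lborel \<partial>lborel)"
    by (rule lborel_pair.Fubini') measurable
  then show ?thesis
    using nn_integral_linear_coordinates_aux[OF assms(1), of "Re B" "Im A" "Re A" "Im B"] det b
    by (simp add: signed_area_def abs_minus_commute mult.commute)
qed

section \<open>Coordinates on a triangle with a vertex at the origin\<close>

lemma signed_area_linear:
  "signed_area A (u *\<^sub>R A + v *\<^sub>R B) = v * signed_area A B"
  "signed_area (u *\<^sub>R A + v *\<^sub>R B) B = u * signed_area A B"
  by (simp_all add: signed_area_def algebra_simps)

text \<open>By Cramer's rule the coordinates \<open>u\<close> and \<open>v\<close> are ratios of
  signed areas, hence unique, so the constraints on the coordinates supplied by the convex hull pass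
  to the given ones.\<close>

lemma mem_origin_triangle_iff:
  assumes "signed_area A B \<noteq> 0"
  shows "u *\<^sub>R A + v *\<^sub>R B \<in> convex hull {0, A, B} \<longleftrightarrow> 0 \<le> u \<and> 0 \<le> v \<and> u + v \<le> 1"
proof
  assume "u *\<^sub>R A + v *\<^sub>R B \<in> convex hull {0, A, B}"
  then obtain u' v' where eq: "u *\<^sub>R A + v *\<^sub>R B = u' *\<^sub>R A + v' *\<^sub>R B"
    and *: "0 \<le> u'" "0 \<le> v'" "u' + v' \<le> 1"
    unfolding convex_hull_3_alt by auto
  have "u = u'" "v = v'"
    using assms signed_area_linear(1)[of A u v B] signed_area_linear(1)[of A u' v' B]
      signed_area_linear(2)[of u A v B] signed_area_linear(2)[of u' A v' B]
    unfolding eq by auto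
  with * show "0 \<le> u \<and> 0 \<le> v \<and> u + v \<le> 1" by simp
qed (unfold convex_hull_3_alt, auto)

text \<open>The shear \<open>u = s - v\<close> followed by the scaling \<open>v = s * \<tau>\<close>.\<close>

lemma nn_integral_unit_triangle:
  assumes [measurable]: "case_prod h \<in> borel_measurable (borel \<Otimes>\<^sub>M borel)"
  shows "(\<integral>\<^sup>+v. \<integral>\<^sup>+u. h u v * indicator {(u, v). 0 \<le> u \<and> 0 \<le> v \<and> u + v \<le> 1} (u, v) \<partial>lborel \<partial>lborel) =
    (\<integral>\<^sup>+s. \<integral>\<^sup>+\<tau>. ennreal s * h (s * (1 - \<tau>)) (s * \<tau>) * indicator ({0..1} \<times> {0..1}) (s, \<tau>) \<partial>lborel \<partial>lborel)"
proof -
  have h[measurable]: "(\<lambda>x. h (f x) (k x)) \<in> borel_measurable M"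
    if "f \<in> borel_measurable M" "k \<in> borel_measurable M" for f k and M :: "'x measure"
    using measurable_compose[OF measurable_Pair[OF that] assms] by simp
  have "(\<integral>\<^sup>+v. \<integral>\<^sup>+u. h u v * indicator {(u, v). 0 \<le> u \<and> 0 \<le> v \<and> u + v \<le> 1} (u, v) \<partial>lborel \<partial>lborel) =
     (\<integral>\<^sup>+v. \<integral>\<^sup>+s. h (s - v) v * indicator {(s, v). 0 \<le> v \<and> v \<le> s \<and> s \<le> 1} (s, v) \<partial>lborel \<partial>lborel)"
  proof (rule nn_integral_cong)
    fix v :: real
    have "(\<integral>\<^sup>+u. h u v * indicator {(u, v). 0 \<le> u \<and> 0 \<le> v \<and> u + v \<le> 1} (u, v) \<partial>lborel) =
       ennreal \<bar>1\<bar> * (\<integral>\<^sup>+s. h (- v + 1 * s) v * indicator {(u, v). 0 \<le> u \<and> 0 \<le> v \<and> u + v \<le> 1} (- v + 1 * s, v) \<partial>lborel)"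
      by (rule nn_integral_real_affine) (auto simp: indicator_def)
    also have "\<dots> = (\<integral>\<^sup>+s. h (s - v) v * indicator {(s, v). 0 \<le> v \<and> v \<le> s \<and> s \<le> 1} (s, v) \<partial>lborel)"
      by (auto intro!: nn_integral_cong split: split_indicator)
    finally show "(\<integral>\<^sup>+u. h u v * indicator {(u, v). 0 \<le> u \<and> 0 \<le> v \<and> u + v \<le> 1} (u, v) \<partial>lborel) =
       (\<integral>\<^sup>+s. h (s - v) v * indicator {(s, v). 0 \<le> v \<and> v \<le> s \<and> s \<le> 1} (s, v) \<partial>lborel)" .
  qed
  also have "\<dots> = (\<integral>\<^sup>+s. \<integral>\<^sup>+v. h (s - v) v * indicator {(s, v). 0 \<le> v \<and> v \<le> s \<and> s \<le> 1} (s, v) \<partial>lborel \<partial>lborel)"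
    by (rule lborel_pair.Fubini') (simp add: indicator_def)
  also have "\<dots> = (\<integral>\<^sup>+s. \<integral>\<^sup>+\<tau>. ennreal s * h (s * (1 - \<tau>)) (s * \<tau>) * indicator ({0..1} \<times> {0..1}) (s, \<tau>) \<partial>lborel \<partial>lborel)"
  \<comment> \<open>The scaling by \<open>s\<close> breaks down only at \<open>s = 0\<close>, a null
    set; for negative \<open>s\<close> both indicators vanish.\<close>
  proof (rule nn_integral_cong_AE, use AE_lborel_singleton[of 0] in eventually_elim)
    fix s :: real assume "s \<noteq> 0"
    show "(\<integral>\<^sup>+v. h (s - v) v * indicator {(s, v). 0 \<le> v \<and> v \<le> s \<and> s \<le> 1} (s, v) \<partial>lborel) =
      (\<integral>\<^sup>+\<tau>. ennreal s * h (s * (1 - \<tau>)) (s * \<tau>) * indicator ({0..1} \<times> {0..1}) (s, \<tau>) \<partial>lborel)"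
    proof (cases "0 < s")
      case False
      then have "indicator {(s, v). 0 \<le> v \<and> v \<le> s \<and> s \<le> 1} (s, v) = (0::ennreal)"
        "indicator ({0..1} \<times> {0..1}) (s, v) = (0::ennreal)" for v :: real
        using \<open>s \<noteq> 0\<close> by (auto split: split_indicator)
      then show ?thesis by simp
    next
      case True
      have "(\<integral>\<^sup>+v. h (s - v) v * indicator {(s, v). 0 \<le> v \<and> v \<le> s \<and> s \<le> 1} (s, v) \<partial>lborel) =
        ennreal \<bar>s\<bar> * (\<integral>\<^sup>+\<tau>. h (s - (0 + s * \<tau>)) (0 + s * \<tau>) *
          indicator {(s, v). 0 \<le> v \<and> v \<le> s \<and> s \<le> 1} (s, 0 + s * \<tau>) \<partial>lborel)"
        by (rule nn_integral_real_affine) (use True in \<open>auto simp: indicator_def\<close>)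
      also have "\<dots> = (\<integral>\<^sup>+\<tau>. ennreal \<bar>s\<bar> * (h (s - (0 + s * \<tau>)) (0 + s * \<tau>) *
          indicator {(s, v). 0 \<le> v \<and> v \<le> s \<and> s \<le> 1} (s, 0 + s * \<tau>)) \<partial>lborel)"
        by (rule nn_integral_cmult[symmetric]) (auto simp: indicator_def)
      also have "\<dots> = (\<integral>\<^sup>+\<tau>. ennreal s * h (s * (1 - \<tau>)) (s * \<tau>) * indicator ({0..1} \<times> {0..1}) (s, \<tau>) \<partial>lborel)"
        using True by (auto intro!: nn_integral_cong simp: zero_le_mult_iff algebra_simps split: split_indicator)
      finally show ?thesis .
    qed
  qed
  finally show ?thesis .
qed

text \<open>Stating the change of variables as an equality of measures needs only nonnegative
  integrals of indicators, yet it transfers both integrability and the values of complex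
  integrals.\<close>

lemma density_origin_triangle_eq_distr:
  assumes C: "signed_area A B \<noteq> 0"
  defines "\<phi> \<equiv> \<lambda>(s, \<tau>). s *\<^sub>R ((1 - \<tau>) *\<^sub>R A + \<tau> *\<^sub>R B)"
  shows "density lborel (indicator (convex hull {0, A, B})) =
    distr (density (lborel \<Otimes>\<^sub>M lborel)
      (\<lambda>(s, \<tau>). ennreal (2 * \<bar>signed_area A B\<bar> * s) * indicator ({0..1} \<times> {0..1}) (s, \<tau>))) borel \<phi>"
    (is "density lborel (indicator ?T) = distr (density _ ?w) borel \<phi>")
proof (rule measure_eqI)
  have T[measurable]: "?T \<in> sets borel"
    by (intro borel_closed compact_imp_closed compact_convex_hull finite_imp_compact) auto
  have [measurable]: "\<phi> \<in> borel_measurable (lborel \<Otimes>\<^sub>M lborel)"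
    unfolding \<phi>_def case_prod_beta' by measurable
  have [measurable]: "?w \<in> borel_measurable (lborel \<Otimes>\<^sub>M lborel)"
    by measurable
  fix X assume "X \<in> sets (density lborel (indicator ?T))"
  then have [measurable]: "X \<in> sets borel" by simp
  let ?h = "\<lambda>u v. indicator X (u *\<^sub>R A + v *\<^sub>R B) :: ennreal"
  have "emeasure (density lborel (indicator ?T)) X = (\<integral>\<^sup>+z. indicator ?T z * indicator X z \<partial>lborel)"
    by (rule emeasure_density) auto
  also have "\<dots> = ennreal (2 * \<bar>signed_area A B\<bar>) *
      (\<integral>\<^sup>+v. \<integral>\<^sup>+u. indicator ?T (u *\<^sub>R A + v *\<^sub>R B) * ?h u v \<partial>lborel \<partial>lborel)"
    by (rule nn_integral_linear_coordinates) (use C in auto)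
  also have "(\<integral>\<^sup>+v. \<integral>\<^sup>+u. indicator ?T (u *\<^sub>R A + v *\<^sub>R B) * ?h u v \<partial>lborel \<partial>lborel) =
      (\<integral>\<^sup>+v. \<integral>\<^sup>+u. ?h u v * indicator {(u, v). 0 \<le> u \<and> 0 \<le> v \<and> u + v \<le> 1} (u, v) \<partial>lborel \<partial>lborel)"
    by (auto intro!: nn_integral_cong simp: mem_origin_triangle_iff[OF C] split: split_indicator)
  also have "\<dots> = (\<integral>\<^sup>+s. \<integral>\<^sup>+\<tau>. ennreal s * ?h (s * (1 - \<tau>)) (s * \<tau>) *
      indicator ({0..1} \<times> {0..1}) (s, \<tau>) \<partial>lborel \<partial>lborel)"
    by (rule nn_integral_unit_triangle) measurable
  also have "\<dots> = (\<integral>\<^sup>+p. ennreal (fst p) * ?h (fst p * (1 - snd p)) (fst p * snd p) *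
      indicator ({0..1} \<times> {0..1}) p \<partial>(lborel \<Otimes>\<^sub>M lborel))"
    by (subst lborel.nn_integral_fst[symmetric]) auto
  also have "ennreal (2 * \<bar>signed_area A B\<bar>) * \<dots> =
      (\<integral>\<^sup>+p. ennreal (2 * \<bar>signed_area A B\<bar>) * (ennreal (fst p) * ?h (fst p * (1 - snd p)) (fst p * snd p) *
      indicator ({0..1} \<times> {0..1}) p) \<partial>(lborel \<Otimes>\<^sub>M lborel))"
    by (rule nn_integral_cmult[symmetric]) measurable
  also have "\<dots> = (\<integral>\<^sup>+p. ?w p * indicator X (\<phi> p) \<partial>(lborel \<Otimes>\<^sub>M lborel))"
    by (intro nn_integral_cong)
      (auto simp: \<phi>_def scaleR_add_right ennreal_mult mult_ac indicator_times split: split_indicator)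
  also have "\<dots> = (\<integral>\<^sup>+p. indicator X (\<phi> p) \<partial>density (lborel \<Otimes>\<^sub>M lborel) ?w)"
    by (rule nn_integral_density[symmetric]) measurable
  also have "\<dots> = (\<integral>\<^sup>+z. indicator X z \<partial>distr (density (lborel \<Otimes>\<^sub>M lborel) ?w) borel \<phi>)"
    by (rule nn_integral_distr[symmetric]) auto
  also have "\<dots> = emeasure (distr (density (lborel \<Otimes>\<^sub>M lborel) ?w) borel \<phi>) X"
    by (rule nn_integral_indicator) simp
  finally show "emeasure (density lborel (indicator ?T)) X =
      emeasure (distr (density (lborel \<Otimes>\<^sub>M lborel) ?w) borel \<phi>) X" .
qed simp

text \<open>Integrability is first carried over to the unit square, where Fubini's theorem requires
  it. The radial variable is put innermost, so that each inner integral runs along one ray.\<close>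

lemma set_integral_origin_triangle:
  fixes f :: "complex \<Rightarrow> complex"
  assumes C: "signed_area A B \<noteq> 0" and [measurable]: "f \<in> borel_measurable borel"
    and int: "set_integrable lborel (convex hull {0, A, B}) f"
  shows "(LINT z:convex hull {0, A, B}|lborel. f z) =
    (LINT \<tau>:{0..1}|lborel. LINT s:{0..1}|lborel.
      (2 * \<bar>signed_area A B\<bar> * s) *\<^sub>R f (s *\<^sub>R ((1 - \<tau>) *\<^sub>R A + \<tau> *\<^sub>R B)))"
proof -
  let ?T = "convex hull {0, A, B}"
  let ?w = "\<lambda>(s, \<tau> :: real). 2 * \<bar>signed_area A B\<bar> * s * indicator ({0..1} \<times> {0..1}) (s, \<tau>) :: real"
  let ?\<phi> = "\<lambda>(s, \<tau>). s *\<^sub>R ((1 - \<tau>) *\<^sub>R A + \<tau> *\<^sub>R B)"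
  let ?N = "density (lborel \<Otimes>\<^sub>M lborel) ?w"
  have T[measurable]: "?T \<in> sets borel"
    by (intro borel_closed compact_imp_closed compact_convex_hull finite_imp_compact) auto
  have [measurable]: "?\<phi> \<in> borel_measurable (lborel \<Otimes>\<^sub>M lborel)"
    unfolding case_prod_beta' by measurable
  have [measurable]: "?w \<in> borel_measurable (lborel \<Otimes>\<^sub>M lborel)"
    by measurable
  have ind: "(indicator ?T :: complex \<Rightarrow> ennreal) = (\<lambda>z. ennreal (indicator ?T z))"
    by (auto split: split_indicator)
  have w: "(\<lambda>(s, \<tau>). ennreal (2 * \<bar>signed_area A B\<bar> * s) * indicator ({0..1} \<times> {0..1}) (s, \<tau>)) =
      (\<lambda>p. ennreal (?w p))"
    by (auto split: split_indicator)
  have eq: "density lborel (\<lambda>z. ennreal (indicator ?T z)) = distr ?N borel ?\<phi>"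
    using density_origin_triangle_eq_distr[OF C] unfolding ind w .
  have w0: "AE p in lborel \<Otimes>\<^sub>M lborel. 0 \<le> ?w p"
    by (auto split: split_indicator)
  have "integrable (density lborel (\<lambda>z. ennreal (indicator ?T z))) f"
    using int unfolding set_integrable_def by (subst integrable_density) auto
  then have "integrable ?N (\<lambda>p. f (?\<phi> p))"
    unfolding eq by (subst (asm) integrable_distr_eq) auto
  then have int2: "integrable (lborel \<Otimes>\<^sub>M lborel) (\<lambda>p. ?w p *\<^sub>R f (?\<phi> p))"
    by (subst (asm) integrable_density[OF _ _ w0]) auto
  have "(LINT z:?T|lborel. f z) = (LINT z|density lborel (\<lambda>z. ennreal (indicator ?T z)). f z)"
    unfolding set_lebesgue_integral_def by (subst integral_density) auto
  also have "\<dots> = (LINT p|?N. f (?\<phi> p))"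
    unfolding eq by (rule integral_distr) auto
  also have "\<dots> = (LINT p|(lborel \<Otimes>\<^sub>M lborel). ?w p *\<^sub>R f (?\<phi> p))"
    by (subst integral_density[OF _ _ w0]) auto
  also have "\<dots> = (LINT \<tau>|lborel. LINT s|lborel. ?w (s, \<tau>) *\<^sub>R f (?\<phi> (s, \<tau>)))"
    using lborel_pair.integral_snd[of "\<lambda>s \<tau>. ?w (s, \<tau>) *\<^sub>R f (?\<phi> (s, \<tau>))"] int2
    by (simp add: case_prod_unfold)
  also have "\<dots> = (LINT \<tau>:{0..1}|lborel. LINT s:{0..1}|lborel.
      (2 * \<bar>signed_area A B\<bar> * s) *\<^sub>R f (s *\<^sub>R ((1 - \<tau>) *\<^sub>R A + \<tau> *\<^sub>R B)))"
    unfolding set_lebesgue_integral_def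
    by (intro Bochner_Integration.integral_cong refl)
      (simp add: indicator_times mult_ac flip: Bochner_Integration.integral_scaleR_right)
  finally show ?thesis .
qed

subsection \<open>The edge integral in the parameter\<close>

lemma borel_measurable_Arg [measurable]: "Arg \<in> borel_measurable borel"
proof -
  have [measurable]: "- \<real>\<^sub>\<le>\<^sub>0 \<in> sets (borel :: complex measure)"
    by (intro borel_comp borel_closed) auto
  have [measurable]: "(\<lambda>z. if z \<in> - \<real>\<^sub>\<le>\<^sub>0 then Arg z else pi) \<in> borel_measurable borel"
    by (rule borel_measurable_continuous_on_if) (auto intro: continuous_on_Arg)
  \<comment> \<open>\<open>Arg\<close> is continuous off the closed negative real axis, constantly
    \<open>pi\<close> on the open one, and 0 at the origin by convention.\<close>
  have "(\<lambda>z. if z = 0 then 0 else if z \<in> - \<real>\<^sub>\<le>\<^sub>0 then Arg z else pi) \<in> borel_measurable borel"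
    by measurable
  also have "(\<lambda>z. if z = 0 then 0 else if z \<in> - \<real>\<^sub>\<le>\<^sub>0 then Arg z else pi) = Arg"
  proof
    fix z
    have "Re z < 0 \<and> Im z = 0" if "z \<noteq> 0" "z \<in> \<real>\<^sub>\<le>\<^sub>0"
      using that unfolding complex_nonpos_Reals_iff complex_eq_iff by auto
    then show "(if z = 0 then 0 else if z \<in> - \<real>\<^sub>\<le>\<^sub>0 then Arg z else pi) = Arg z"
      using Arg_eq_pi[of z] by (auto simp: Arg_zero)
  qed
  finally show ?thesis .
qed

lemma continuous_on_zernike_R [continuous_intros]:
  "continuous_on S f \<Longrightarrow> continuous_on S (\<lambda>x. zernike_R n m (f x))"
  unfolding zernike_R_def by (intro continuous_intros)

lemma borel_measurable_zernike_V [measurable]: "zernike_V n m \<in> borel_measurable borel"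
proof -
  have [measurable]: "zernike_R n m \<in> borel_measurable borel"
    by (intro borel_measurable_continuous_onI continuous_intros)
  have [measurable]: "cis \<in> borel_measurable borel"
    by (intro borel_measurable_continuous_onI continuous_intros)
  show ?thesis
    unfolding zernike_V_def[abs_def] by measurable
qed

lemma borel_measurable_cnj_zernike_V [measurable]:
  "(\<lambda>z. cnj (zernike_V n m z)) \<in> borel_measurable borel"
  by (rule measurable_compose[OF borel_measurable_zernike_V])
    (intro borel_measurable_continuous_onI continuous_intros)

lemma set_integrable_cnj_zernike_V:
  assumes [measurable]: "S \<in> sets borel" and "bounded S"
  shows "set_integrable lborel S (\<lambda>z. cnj (zernike_V n m z))"
proof -
  obtain K where K: "\<And>z. z \<in> S \<Longrightarrow> z \<in> cball 0 K"
    using \<open>bounded S\<close> unfolding bounded_iff mem_cball_0 by blast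
  let ?g = "\<lambda>z. zernike_norm n * zernike_R n m (cmod z)"
  have "compact (?g ` cball 0 K)"
    by (intro compact_continuous_image continuous_intros) auto
  then obtain M where M: "\<And>z. z \<in> cball 0 K \<Longrightarrow> \<bar>?g z\<bar> \<le> M"
    unfolding compact_eq_bounded_closed bounded_iff real_norm_def by blast
  show ?thesis
    unfolding set_integrable_def
  proof (rule integrableI_bounded_set_indicator)
    show "emeasure lborel S < \<infinity>"
      using \<open>bounded S\<close> by (rule emeasure_bounded_finite)
    show "AE z in lborel. z \<in> S \<longrightarrow> norm (cnj (zernike_V n m z)) \<le> M"
      using K M by (auto simp: zernike_V_def norm_mult abs_mult)
  qed auto
qed

lemma zernike_V_scaleR:
  assumes "0 < s"
  shows "zernike_V n m (s *\<^sub>R z) =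
    of_real (zernike_norm n) * of_real (zernike_R n m (s * cmod z)) * cis (of_int m * Arg z)"
  using assms by (simp add: zernike_V_def scaleR_conv_of_real norm_mult)

section \<open>The radial primitive\<close>

lemma zernike_Q_has_real_derivative:
  "(zernike_Q n m has_real_derivative r * zernike_R n m r) (at r)"
proof -
  \<comment> \<open>This bound puts both the base point 0 and \<open>r\<close> in the interior of
    the interval, so the derivative within it is the full derivative.\<close>
  let ?K = "\<bar>r\<bar> + 1"
  have "((\<lambda>u. LBINT s=ereal 0..ereal u. s * zernike_R n m s) has_vector_derivative r * zernike_R n m r)
      (at r within {- ?K..?K})"
    by (rule interval_integral_FTC2) (auto intro!: continuous_intros)
  moreover have "at r within {- ?K..?K} = at r"
    by (rule at_within_interior) auto
  ultimately show ?thesis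
    by (simp add: has_real_derivative_iff_has_vector_derivative zernike_Q_def[abs_def])
qed

lemma continuous_on_zernike_Q [continuous_intros]:
  assumes "continuous_on S f"
  shows "continuous_on S (\<lambda>x. zernike_Q n m (f x))"
proof (rule continuous_on_compose2[OF _ assms])
  show "continuous_on UNIV (zernike_Q n m)"
    by (meson DERIV_isCont continuous_at_imp_continuous_on zernike_Q_has_real_derivative)
qed simp

lemma zernike_Q_0 [simp]: "zernike_Q n m 0 = 0"
  by (simp add: zernike_Q_def)

text \<open>Substituting \<rho> s for the variable of the primitive produces one factor \<rho> from
  the weight and one from the differential. This is the origin of the denominator in
  \<open>zernike_A\<close>.\<close>

lemma set_integral_scaled_zernike_R:
  assumes "0 < \<rho>"
  shows "(LINT s:{0..1}|lborel. s * zernike_R n m (s * \<rho>)) = zernike_Q n m \<rho> / \<rho>\<^sup>2"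
proof -
  have "(LBINT s=ereal 0..ereal 1. \<rho> *\<^sub>R ((\<rho> * s) * zernike_R n m (\<rho> * s))) =
      (LBINT s=ereal (\<rho> * 0)..ereal (\<rho> * 1). s * zernike_R n m s)"
    by (rule interval_integral_substitution_finite[where g = "\<lambda>s. \<rho> * s" and g' = "\<lambda>_. \<rho>"])
      (auto intro!: derivative_eq_intros continuous_intros)
  then have "zernike_Q n m \<rho> = (LBINT s=ereal 0..ereal 1. \<rho>\<^sup>2 * (s * zernike_R n m (s * \<rho>)))"
    by (simp add: zernike_Q_def power2_eq_square mult_ac)
  also have "\<dots> = \<rho>\<^sup>2 * (LINT s:{0..1}|lborel. s * zernike_R n m (s * \<rho>))"
    by (subst interval_integral_Icc) auto
  finally show ?thesis
    using assms by simp
qed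

section \<open>Radial integration over the triangle of an edge\<close>

lemma signed_area_edge_point:
  "signed_area A (edge_point A B t) = (1 + t) / 2 * signed_area A B"
  "signed_area (edge_point A B t) B = (1 - t) / 2 * signed_area A B"
  unfolding edge_point_def by (simp_all add: signed_area_linear)

text \<open>At the origin both area ratios (1 + t)/2 and (1 - t)/2 would have to vanish, but they
  add up to 1.\<close>

lemma edge_point_nonzero:
  assumes "signed_area A B \<noteq> 0"
  shows "edge_point A B t \<noteq> 0"
proof
  assume "edge_point A B t = 0"
  then have "signed_area A 0 = (1 + t) / 2 * signed_area A B"
    "signed_area 0 B = (1 - t) / 2 * signed_area A B"
    using signed_area_edge_point[of A B t] signed_area_edge_point[of A B t] by auto
  then show False using assms by (auto simp: signed_area_def)
qed

text \<open>Along a ray the argument is constant, so the angular factor leaves the integral and only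
  the radial polynomial is integrated.\<close>

lemma set_integral_zernike_V_ray:
  assumes "z \<noteq> 0"
  shows "(LINT s:{0..1}|lborel. (c * s) *\<^sub>R cnj (zernike_V n m (s *\<^sub>R z))) =
    of_real c * of_real (zernike_norm n) *
      (of_real (zernike_Q n m (cmod z)) * cis (- of_int m * Arg z) / of_real ((cmod z)\<^sup>2))"
proof -
  let ?K = "of_real c * of_real (zernike_norm n) * cis (- of_int m * Arg z)"
  have "(LINT s:{0..1}|lborel. (c * s) *\<^sub>R cnj (zernike_V n m (s *\<^sub>R z))) =
      (LINT s:{0..1}|lborel. ?K * of_real (s * zernike_R n m (s * cmod z)))"
  proof (rule set_lebesgue_integral_cong)
    show "\<forall>s. s \<in> {0..1} \<longrightarrow> (c * s) *\<^sub>R cnj (zernike_V n m (s *\<^sub>R z)) =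
        ?K * of_real (s * zernike_R n m (s * cmod z))"
    proof (intro allI impI)
      fix s :: real assume s: "s \<in> {0..1}"
      show "(c * s) *\<^sub>R cnj (zernike_V n m (s *\<^sub>R z)) =
          ?K * of_real (s * zernike_R n m (s * cmod z))"
      \<comment> \<open>At the origin the argument is not that of the ray, but the weight
        \<open>s\<close> vanishes there.\<close>
      proof (cases "s = 0")
        case False
        with s have "0 < s" by simp
        show ?thesis
          unfolding zernike_V_scaleR[OF \<open>0 < s\<close>] by (simp add: scaleR_conv_of_real cis_cnj)
      qed simp
    qed
  qed simp
  also have "\<dots> = ?K * of_real (zernike_Q n m (cmod z) / (cmod z)\<^sup>2)"
    using assms by (simp only: set_integral_mult_right set_integral_complex_of_real)
      (simp add: set_integral_scaled_zernike_R)
  finally show ?thesis by (simp add: mult_ac)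
qed

lemma edge_moment_degenerate: "signed_area A B = 0 \<Longrightarrow> edge_moment n m A B = 0"
  by (simp add: edge_moment_def orient_def)

theorem edge_moment_eq_integral_zernike_A:
  "edge_moment n m A B =
    of_real (zernike_norm n) * (LBINT t=ereal (-1)..ereal 1. zernike_A n m A B t)"
proof (cases "signed_area A B = 0")
  case True
  then show ?thesis
    by (simp add: edge_moment_degenerate zernike_A_def[abs_def])
next
  case C: False
  \<comment> \<open>The orientation turns the unsigned Jacobian into the signed constant of
    \<open>zernike_A\<close>.\<close>
  have orient: "of_real (orient A B) * (of_real \<bar>signed_area A B\<bar> * x) = of_real (signed_area A B) * x"
    for x :: complex
    by (simp add: orient_def mult_sgn_abs flip: mult.assoc of_real_mult)
  have bdd: "bounded (convex hull {0, A, B})"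
    by (simp add: finite_imp_bounded bounded_convex_hull)
  have T: "convex hull {0, A, B} \<in> sets borel"
    by (intro borel_closed compact_imp_closed compact_convex_hull finite_imp_compact) auto
  have seg: "(1 - \<tau>) *\<^sub>R A + \<tau> *\<^sub>R B = edge_point A B (- 1 + 2 * \<tau>)" for \<tau>
    by (simp add: edge_point_def)
  have "edge_moment n m A B = of_real (orient A B) * (LINT \<tau>:{0..1}|lborel.
      LINT s:{0..1}|lborel. (2 * \<bar>signed_area A B\<bar> * s) *\<^sub>R
        cnj (zernike_V n m (s *\<^sub>R edge_point A B (- 1 + 2 * \<tau>))))"
    unfolding edge_moment_def
    by (subst set_integral_origin_triangle[OF C _ set_integrable_cnj_zernike_V[OF T bdd]])
      (simp_all add: seg)
  also have "\<dots> = (LINT \<tau>:{0..1}|lborel. of_real (zernike_norm n) * (2 *\<^sub>R zernike_A n m A B (- 1 + 2 * \<tau>)))"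
    unfolding set_integral_zernike_V_ray[OF edge_point_nonzero[OF C]] set_integral_mult_right[symmetric]
    by (rule set_lebesgue_integral_cong)
      (simp_all add: zernike_A_def orient[symmetric] scaleR_conv_of_real mult_ac)
  also have "\<dots> = of_real (zernike_norm n) * (2 *\<^sub>R (LINT \<tau>:{0..1}|lborel. zernike_A n m A B (- 1 + 2 * \<tau>)))"
    by (simp only: set_integral_mult_right set_integral_scaleR_right)
  \<comment> \<open>The factor 2 left over from the Jacobian is the derivative of
    \<open>- 1 + 2 * \<tau>\<close>, which maps the unit interval onto the parameter interval of the
    edge.\<close>
  also have "2 *\<^sub>R (LINT \<tau>:{0..1}|lborel. zernike_A n m A B (- 1 + 2 * \<tau>)) =
      (LINT t:{-1..1}|lborel. zernike_A n m A B t)"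
  proof -
    have ind: "indicator {-1..1} (- 1 + 2 * \<tau>) = (indicator {0..1} \<tau> :: real)" for \<tau> :: real
      by (auto split: split_indicator)
    show ?thesis
      unfolding set_lebesgue_integral_def
      using lborel_integral_real_affine[of 2 "\<lambda>t. indicator {-1..1} t *\<^sub>R zernike_A n m A B t" "-1"]
      by (simp only: ind) simp
  qed
  finally show ?thesis
    by (simp add: interval_integral_Icc)
qed

subsection \<open>The edge integral in the polar angle\<close>

lemma signed_area_polar:
  assumes "polar_angle A \<alpha>" "polar_angle B \<beta>"
  shows "signed_area A B = cmod A * cmod B * sin (\<beta> - \<alpha>) / 2"
proof -
  have "Re A = cmod A * cos \<alpha>" "Im A = cmod A * sin \<alpha>" "Re B = cmod B * cos \<beta>" "Im B = cmod B * sin \<beta>"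
    using assms[unfolded polar_angle_def, THEN arg_cong, of Re] assms[unfolded polar_angle_def, THEN arg_cong, of Im]
    by simp_all
  then show ?thesis
    by (simp add: signed_area_def sin_diff algebra_simps)
qed

lemma edge_radius_commute: "edge_radius A B = edge_radius B A"
  by (simp add: edge_radius_def closed_segment_commute fun_eq_iff)

text \<open>Vanishing area leaves three cases: \<open>A\<close> or \<open>B\<close> is the origin,
  or they lie in opposite directions. In each the segment contains the origin and otherwise stays on
  the rays at \<alpha> and \<beta>, so a ray strictly between them meets it only at the
  origin.\<close>

lemma edge_radius_degenerate_aux:
  assumes pol: "polar_angle A \<alpha>" "polar_angle B \<beta>" and C: "signed_area A B = 0"
    and \<theta>: "\<alpha> < \<theta>" "\<theta> < \<beta>" "\<beta> - \<alpha> \<le> pi"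
  shows "edge_radius A B \<theta> = 0"
proof -
  have A: "A = of_real (cmod A) * cis \<alpha>" and B: "B = of_real (cmod B) * cis \<beta>"
    using pol by (simp_all add: polar_angle_def)
  have "cmod A * cmod B * sin (\<beta> - \<alpha>) = 0"
    using C signed_area_polar[OF pol] by simp
  moreover have "sin (\<beta> - \<alpha>) \<noteq> 0" if "\<beta> - \<alpha> \<noteq> pi"
    using that \<theta> sin_gt_zero[of "\<beta> - \<alpha>"] by auto
  ultimately consider "A = 0" | "B = 0" | "A \<noteq> 0" "B \<noteq> 0" "\<beta> = \<alpha> + pi"
    by force
  then have cases: "A = 0 \<or> B = 0 \<or> (A \<noteq> 0 \<and> B \<noteq> 0 \<and> \<beta> = \<alpha> + pi)"
    by cases auto
  have zero: "0 \<in> closed_segment A B"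
    using cases
  proof (elim disjE conjE)
    assume nz: "A \<noteq> 0" "B \<noteq> 0" and \<beta>: "\<beta> = \<alpha> + pi"
    define a b where "a = cmod A" and "b = cmod B"
    have sum: "0 < a" "0 < b" using nz by (simp_all add: a_def b_def)
    \<comment> \<open>The origin divides the segment in the ratio of the distances of its
      endpoints.\<close>
    let ?u = "a / (a + b)"
    have cis: "cis \<beta> = - cis \<alpha>" by (simp add: \<beta> complex_eq_iff)
    have AB: "A = a *\<^sub>R cis \<alpha>" "B = - (b *\<^sub>R cis \<alpha>)"
      using A B unfolding a_def b_def scaleR_conv_of_real cis mult_minus_right .
    have "(1 - ?u) *\<^sub>R A + ?u *\<^sub>R B = ((1 - ?u) * a - ?u * b) *\<^sub>R cis \<alpha>"
      unfolding AB by (simp add: algebra_simps)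
    also have "(1 - ?u) * a - ?u * b = 0"
      using sum by (simp add: field_simps)
    finally show ?thesis
      unfolding closed_segment_def using sum by (intro CollectI exI[of _ ?u]) auto
  qed auto
  have unique: "r = 0" if r: "0 \<le> r" "of_real r * cis \<theta> \<in> closed_segment A B" for r
  proof -
    obtain u where u: "0 \<le> u" "u \<le> 1"
      and eq: "of_real r * cis \<theta> = (1 - u) *\<^sub>R A + u *\<^sub>R B"
      using r(2) unfolding closed_segment_def by auto
    define a b where "a = (1 - u) * cmod A" and "b = u * cmod B"
    have eq': "of_real r * cis \<theta> = of_real a * cis \<alpha> + of_real b * cis \<beta>"
      unfolding eq
      by (simp only: a_def b_def scaleR_conv_of_real of_real_mult mult.assoc A[symmetric] B[symmetric])
    have re: "r * cos \<theta> = a * cos \<alpha> + b * cos \<beta>" and im: "r * sin \<theta> = a * sin \<alpha> + b * sin \<beta>"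
      using eq' by (simp_all add: complex_eq_iff)
    \<comment> \<open>Taking the cross product with the direction \<theta> eliminates
      \<open>r\<close>.\<close>
    have "a * sin (\<theta> - \<alpha>) = b * sin (\<beta> - \<theta>)"
    proof -
      have "(r * cos \<theta>) * sin \<theta> = (r * sin \<theta>) * cos \<theta>" by simp
      then show ?thesis
        unfolding re im by (simp add: sin_diff algebra_simps)
    qed
    moreover have "0 < sin (\<theta> - \<alpha>)" "0 < sin (\<beta> - \<theta>)"
      using \<theta> by (auto intro!: sin_gt_zero)
    moreover have "sin (\<beta> - \<theta>) = sin (\<theta> - \<alpha>)" if "\<beta> = \<alpha> + pi"
      using that by (simp add: sin_diff)
    \<comment> \<open>If one endpoint is the origin, then \<open>a\<close> or \<open>b\<close> is
      zero, and positivity of the sines forces the other to vanish. For opposite directions the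
      sines agree, so \<open>a = b\<close> and the two contributions cancel.\<close>
    ultimately have "(a = 0 \<and> b = 0) \<or> (a = b \<and> \<beta> = \<alpha> + pi)"
      using cases by (auto simp: a_def b_def)
    then have "of_real r * cis \<theta> = 0"
      unfolding eq' by (auto simp: complex_eq_iff)
    then show "r = 0" by simp
  qed
  show ?thesis
    unfolding edge_radius_def by (rule the_equality) (use zero unique in auto)
qed

lemma edge_radius_degenerate:
  assumes pol: "polar_angle A \<alpha>" "polar_angle B \<beta>" and C: "signed_area A B = 0"
    and \<theta>: "min \<alpha> \<beta> < \<theta>" "\<theta> < max \<alpha> \<beta>" "\<bar>\<beta> - \<alpha>\<bar> \<le> pi"
  shows "edge_radius A B \<theta> = 0"
proof (cases "\<alpha> < \<beta>")
  case True
  then show ?thesis using assms by (intro edge_radius_degenerate_aux[of A \<alpha> B \<beta>]) auto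
next
  case False
  have "signed_area B A = 0" using C by (simp add: signed_area_def algebra_simps)
  then show ?thesis
    unfolding edge_radius_commute[of A B] using False assms
    by (intro edge_radius_degenerate_aux[of B \<beta> A \<alpha>]) auto
qed

lemma integral_angular_integrand_degenerate:
  assumes "polar_angle A \<alpha>" "polar_angle B \<beta>" "signed_area A B = 0" "\<bar>\<beta> - \<alpha>\<bar> \<le> pi"
  shows "(LBINT \<theta>=ereal \<alpha>..ereal \<beta>. angular_integrand n m A B \<theta>) = 0"
proof -
  have "(LBINT \<theta>=ereal \<alpha>..ereal \<beta>. angular_integrand n m A B \<theta>) = (LBINT \<theta>=ereal \<alpha>..ereal \<beta>. 0)"
  \<comment> \<open>Only angles strictly between the limits are compared: a limiting ray may contain
    a whole piece of the segment, and then \<open>edge_radius\<close> is unspecified.\<close>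
  proof (rule interval_integral_cong)
    fix \<theta> assume "\<theta> \<in> einterval (min (ereal \<alpha>) (ereal \<beta>)) (max (ereal \<alpha>) (ereal \<beta>))"
    then have "min \<alpha> \<beta> < \<theta>" "\<theta> < max \<alpha> \<beta>"
      by (auto simp: einterval_def min_def max_def split: if_splits)
    then show "angular_integrand n m A B \<theta> = 0"
      using edge_radius_degenerate[OF assms(1-3) _ _ assms(4)] by (simp add: angular_integrand_def)
  qed
  then show ?thesis by simp
qed

section \<open>A continuous polar angle along a nondegenerate edge\<close>

lemma cis_int_mult_cong: "cis x = cis y \<Longrightarrow> cis (- of_int m * x) = cis (- of_int m * y)"
  by (metis cis_power_int of_int_minus)

text \<open>\<open>Arg\<close> along the edge may jump at the negative real axis. Dividing by
  \<open>A\<close> makes the edge start at 1, and as it turns by less than pi, the principal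
  logarithm then gives a continuous angle; adding \<alpha> restores the prescribed starting
  value.\<close>

definition edge_angle :: "complex \<Rightarrow> complex \<Rightarrow> real \<Rightarrow> real \<Rightarrow> real" where
  "edge_angle A B \<alpha> t = \<alpha> + Im (Ln (edge_point A B t / A))"

context
  fixes A B :: complex and \<alpha> :: real
  assumes C: "signed_area A B \<noteq> 0" and \<alpha>: "polar_angle A \<alpha>"
begin

lemma edge_endpoints_nonzero: "A \<noteq> 0" "B \<noteq> 0"
  using C by (auto simp: signed_area_def)

text \<open>For t > -1 the imaginary part of the quotient is a positive multiple of the signed area,
  so the rotated edge stays in one open half plane after leaving 1.\<close>

lemma edge_point_quotient_slit:
  assumes "t \<in> {-1..1}"
  shows "edge_point A B t / A \<notin> \<real>\<^sub>\<le>\<^sub>0"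
proof (cases "t = -1")
  case True
  then show ?thesis using edge_endpoints_nonzero by (simp add: edge_point_def)
next
  case False
  have "2 * signed_area A z = Im z * Re A - Re z * Im A" for z
    by (simp add: signed_area_def mult.commute)
  then have "Im (edge_point A B t / A) = 2 * signed_area A (edge_point A B t) / (cmod A)\<^sup>2"
    by (simp add: Im_divide cmod_power2)
  also have "\<dots> \<noteq> 0"
    using C False assms edge_endpoints_nonzero by (simp add: signed_area_edge_point)
  finally show ?thesis by (simp add: complex_nonpos_Reals_iff)
qed

lemma edge_point_has_vector_derivative:
  "(edge_point A B has_vector_derivative ((1/2) *\<^sub>R (B - A))) (at t within S)"
proof -
  have eq: "edge_point A B = (\<lambda>t. (1/2) *\<^sub>R (A + B) + t *\<^sub>R ((1/2) *\<^sub>R (B - A)))"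
    by (rule ext) (simp add: edge_point_def complex_eq_iff field_simps)
  show ?thesis
    unfolding eq has_vector_derivative_def by (auto intro!: derivative_eq_intros)
qed

text \<open>The angular velocity of P is Im (P' / P), the cross product of P and P' over |P|^2. With
  P' = (B - A)/2 this cross product does not depend on the parameter and equals the signed
  area.\<close>

lemma edge_angle_has_real_derivative:
  assumes "t \<in> {-1..1}"
  shows "(edge_angle A B \<alpha> has_real_derivative signed_area A B / (cmod (edge_point A B t))\<^sup>2) (at t within S)"
proof -
  let ?P = "edge_point A B t"
  have "((\<lambda>t. edge_point A B t / A) has_vector_derivative ((1/2) *\<^sub>R (B - A)) / A) (at t within S)"
    by (intro has_vector_derivative_divide edge_point_has_vector_derivative)
  from field_vector_diff_chain_within[OF this has_field_derivative_at_within[OF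
      has_field_derivative_Ln[OF edge_point_quotient_slit[OF assms]]]]
  have "((Ln \<circ> (\<lambda>t. edge_point A B t / A)) has_vector_derivative
      ((1/2) *\<^sub>R (B - A)) / A * inverse (?P / A)) (at t within S)" .
  moreover have "v / A * inverse (?P / A) = v / ?P" for v
    using edge_endpoints_nonzero by simp
  ultimately have "((\<lambda>t. Ln (edge_point A B t / A)) has_vector_derivative
      ((1/2) *\<^sub>R (B - A)) / ?P) (at t within S)"
    by (simp only: o_def)
  from bounded_linear.has_vector_derivative[OF bounded_linear_Im this]
  have "((\<lambda>t. Im (Ln (edge_point A B t / A))) has_real_derivative
      Im (((1/2) *\<^sub>R (B - A)) / ?P)) (at t within S)"
    by (simp add: has_real_derivative_iff_has_vector_derivative)
  moreover have "Im (((1/2) *\<^sub>R (B - A)) / ?P) = signed_area A B / (cmod ?P)\<^sup>2"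
  proof -
    have "Im ((1/2) *\<^sub>R (B - A)) * Re ?P - Re ((1/2) *\<^sub>R (B - A)) * Im ?P = signed_area A B"
      by (simp add: edge_point_def signed_area_def field_simps)
    then show ?thesis
      unfolding Im_divide cmod_power2 by (simp only:)
  qed
  ultimately have "((\<lambda>t. Im (Ln (edge_point A B t / A))) has_real_derivative
      signed_area A B / (cmod ?P)\<^sup>2) (at t within S)"
    by (simp only:)
  from DERIV_add[OF DERIV_const[of \<alpha>] this] show ?thesis
    unfolding edge_angle_def[abs_def] by simp
qed

lemma cis_edge_angle: "cis (edge_angle A B \<alpha> t) = sgn (edge_point A B t)"
proof -
  have P: "edge_point A B t / A \<noteq> 0"
    using edge_point_nonzero[OF C] edge_endpoints_nonzero by simp
  have "cis \<alpha> = sgn A"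
    using arg_cong[OF \<alpha>[unfolded polar_angle_def], of "\<lambda>z. z / of_real (cmod A)"] edge_endpoints_nonzero
    by (simp add: sgn_eq)
  moreover have "cis (Im (Ln (edge_point A B t / A))) = sgn (edge_point A B t / A)"
    using cis_Arg[OF P] Arg_eq_Im_Ln[OF P] by simp
  ultimately have "cis (edge_angle A B \<alpha> t) = sgn A * sgn (edge_point A B t / A)"
    by (simp add: edge_angle_def flip: cis_mult)
  also have "\<dots> = sgn (A * (edge_point A B t / A))"
    by (rule sgn_mult[symmetric])
  also have "A * (edge_point A B t / A) = edge_point A B t"
    using edge_endpoints_nonzero by simp
  finally show ?thesis .
qed

text \<open>Solving the equation of the line \<open>AB\<close> for the distance along the ray at angle \<open>\<theta>\<close>.\<close>

lemma ray_meets_edge_line: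
  assumes "of_real r * cis \<theta> = (1 - u) *\<^sub>R A + u *\<^sub>R B"
  shows "r * signed_area (cis \<theta>) (B - A) = signed_area A B"
proof -
  have "r * signed_area (cis \<theta>) (B - A) = signed_area (of_real r * cis \<theta>) (B - A)"
    by (simp add: signed_area_def algebra_simps)
  also have "\<dots> = signed_area A B"
    unfolding assms by (simp add: signed_area_def field_simps)
  finally show ?thesis .
qed

text \<open>The equation of the line has a nonzero coefficient because its right-hand side is
  nonzero; this makes the hit radius unique. The quotient form is there for continuity: it replaces
  a definite description by an explicit function of the angle.\<close>

lemma edge_radius_edge_angle:
  assumes t: "t \<in> {-1..1}"
  shows "signed_area (cis (edge_angle A B \<alpha> t)) (B - A) \<noteq> 0"
    and "edge_radius A B (edge_angle A B \<alpha> t) = cmod (edge_point A B t)"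
    and "edge_radius A B (edge_angle A B \<alpha> t) =
      signed_area A B / signed_area (cis (edge_angle A B \<alpha> t)) (B - A)"
proof -
  let ?P = "edge_point A B t" and ?\<theta> = "edge_angle A B \<alpha> t"
  have P: "of_real (cmod ?P) * cis ?\<theta> = ?P"
    by (simp add: cis_edge_angle sgn_eq edge_point_nonzero[OF C])
  also have "\<dots> = (1 - (1 + t) / 2) *\<^sub>R A + ((1 + t) / 2) *\<^sub>R B"
    unfolding edge_point_def by (simp add: field_simps)
  finally have P': "of_real (cmod ?P) * cis ?\<theta> = (1 - (1 + t) / 2) *\<^sub>R A + ((1 + t) / 2) *\<^sub>R B" .
  have eq: "cmod ?P * signed_area (cis ?\<theta>) (B - A) = signed_area A B"
    by (rule ray_meets_edge_line[OF P'])
  then show nz: "signed_area (cis ?\<theta>) (B - A) \<noteq> 0" using C by auto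
  show *: "edge_radius A B ?\<theta> = cmod ?P"
    unfolding edge_radius_def
  proof (rule the_equality)
    show "0 \<le> cmod ?P \<and> of_real (cmod ?P) * cis ?\<theta> \<in> closed_segment A B"
      unfolding P' closed_segment_def using t by (auto intro!: exI[of _ "(1 + t) / 2"])
  next
    fix r assume "0 \<le> r \<and> of_real r * cis ?\<theta> \<in> closed_segment A B"
    then obtain u where "of_real r * cis ?\<theta> = (1 - u) *\<^sub>R A + u *\<^sub>R B"
      unfolding closed_segment_def by auto
    from ray_meets_edge_line[OF this] eq nz show "r = cmod ?P"
      by (metis mult_right_cancel)
  qed
  show "edge_radius A B ?\<theta> = signed_area A B / signed_area (cis ?\<theta>) (B - A)"
    unfolding * using eq nz by (simp add: field_simps)
qed

lemma continuous_on_angular_integrand: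
  "continuous_on (edge_angle A B \<alpha> ` {-1..1}) (angular_integrand n m A B)"
proof -
  have "continuous_on (edge_angle A B \<alpha> ` {-1..1})
    (\<lambda>\<theta>. of_real (zernike_Q n m (signed_area A B / signed_area (cis \<theta>) (B - A))) * cis (- of_int m * \<theta>))"
    using edge_radius_edge_angle(1) unfolding signed_area_def
    by (intro continuous_intros) auto
  then show ?thesis
    by (rule continuous_on_eq) (auto simp: angular_integrand_def edge_radius_edge_angle(3))
qed

lemma zernike_A_eq_angular_integrand:
  assumes "t \<in> {-1..1}"
  shows "zernike_A n m A B t =
    (signed_area A B / (cmod (edge_point A B t))\<^sup>2) *\<^sub>R angular_integrand n m A B (edge_angle A B \<alpha> t)"
proof -
  \<comment> \<open>The continuous angle and \<open>Arg\<close> differ by a multiple of 2 pi, which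
    an integer \<open>m\<close> does not see.\<close>
  have "cis (- of_int m * edge_angle A B \<alpha> t) = cis (- of_int m * Arg (edge_point A B t))"
    by (rule cis_int_mult_cong) (simp add: cis_edge_angle cis_Arg edge_point_nonzero[OF C])
  then show ?thesis
    by (simp add: zernike_A_def angular_integrand_def edge_radius_edge_angle(2)[OF assms] scaleR_conv_of_real)
qed

lemma edge_angle_start: "edge_angle A B \<alpha> (-1) = \<alpha>"
  using edge_endpoints_nonzero by (simp add: edge_angle_def edge_point_def)

text \<open>The bound puts \<beta> - \<alpha> in the closed interval from -pi to pi, and nonzero
  area excludes -pi, where the sine vanishes. So the difference is the principal argument of
  \<open>B / A\<close>, not merely congruent to it.\<close>

lemma edge_angle_end:
  assumes \<beta>: "polar_angle B \<beta>" and le: "\<bar>\<beta> - \<alpha>\<bar> \<le> pi"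
  shows "edge_angle A B \<alpha> 1 = \<beta>"
proof -
  have "\<beta> - \<alpha> \<noteq> - pi"
  proof
    assume "\<beta> - \<alpha> = - pi"
    with C signed_area_polar[OF \<alpha> \<beta>] show False by simp
  qed
  with le have "\<beta> - \<alpha> \<in> {- pi<..pi}" by auto
  moreover have "B / A = rcis (cmod B / cmod A) (\<beta> - \<alpha>)"
  proof -
    have A: "A = rcis (cmod A) \<alpha>" and B: "B = rcis (cmod B) \<beta>"
      using \<alpha> \<beta> unfolding polar_angle_def rcis_def .
    show ?thesis
      using arg_cong2[OF B A, of "(/)"] unfolding rcis_divide .
  qed
  ultimately have "Arg (B / A) = \<beta> - \<alpha>"
    using edge_endpoints_nonzero by (simp add: Arg_rcis)
  then show ?thesis
    using edge_endpoints_nonzero by (simp add: edge_angle_def edge_point_def Arg_eq_Im_Ln)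
qed

lemma integral_angular_integrand_nondegenerate:
  assumes "polar_angle B \<beta>" "\<bar>\<beta> - \<alpha>\<bar> \<le> pi"
  shows "(LBINT \<theta>=ereal \<alpha>..ereal \<beta>. angular_integrand n m A B \<theta>) =
    (LBINT t=ereal (-1)..ereal 1. zernike_A n m A B t)"
proof -
  let ?d = "\<lambda>t. signed_area A B / (cmod (edge_point A B t))\<^sup>2"
  have "(LBINT t=ereal (-1)..ereal 1. zernike_A n m A B t) =
      (LBINT t=ereal (-1)..ereal 1. ?d t *\<^sub>R angular_integrand n m A B (edge_angle A B \<alpha> t))"
    by (rule interval_integral_cong) (auto simp: einterval_def intro!: zernike_A_eq_angular_integrand)
  also have "\<dots> = (LBINT \<theta>=ereal (edge_angle A B \<alpha> (-1))..ereal (edge_angle A B \<alpha> 1). angular_integrand n m A B \<theta>)"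
  proof (rule interval_integral_substitution_finite)
    show "continuous_on {-1..1} ?d"
      unfolding edge_point_def using edge_point_nonzero[OF C]
      by (intro continuous_intros) (auto simp: edge_point_def)
  qed (auto intro: continuous_on_angular_integrand edge_angle_has_real_derivative)
  finally show ?thesis
    by (simp add: edge_angle_start edge_angle_end[OF assms])
qed

end

section \<open>Angular form of the edge moment and its orientation\<close>

theorem edge_moment_eq_angular_integral:
  assumes "polar_angle A \<alpha>" "polar_angle B \<beta>" "\<bar>\<beta> - \<alpha>\<bar> \<le> pi"
  shows "edge_moment n m A B =
    of_real (zernike_norm n) * (LBINT \<theta>=ereal \<alpha>..ereal \<beta>. angular_integrand n m A B \<theta>)"
proof (cases "signed_area A B = 0")
  case True
  then show ?thesis
    using integral_angular_integrand_degenerate[OF assms(1,2) True assms(3)]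
    by (simp add: edge_moment_degenerate)
next
  case False
  then show ?thesis
    using integral_angular_integrand_nondegenerate[OF False assms]
    by (simp add: edge_moment_eq_integral_zernike_A)
qed

text \<open>The signed area has the sign of sin (\<beta> - \<alpha>), which within the bound pi says
  whether the limits are in increasing order. Hence reversing the limits and \<open>orient\<close>
  account for the same sign.\<close>

lemma angular_integral_orient:
  assumes pol: "polar_angle A \<alpha>" "polar_angle B \<beta>" and le: "\<bar>\<beta> - \<alpha>\<bar> \<le> pi" and C: "signed_area A B \<noteq> 0"
  shows "(LBINT \<theta>=ereal \<alpha>..ereal \<beta>. f \<theta>) =
    of_real (orient A B) * (LINT \<theta>:closed_segment \<alpha> \<beta>|lborel. (f \<theta> :: complex))"
proof -
  have eq: "signed_area A B = cmod A * cmod B * sin (\<beta> - \<alpha>) / 2"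
    by (rule signed_area_polar[OF pol])
  show ?thesis
  proof (cases "\<alpha> \<le> \<beta>")
    case True
    then have "0 \<le> signed_area A B"
      unfolding eq using le by (intro divide_nonneg_pos mult_nonneg_nonneg sin_ge_zero) auto
    with C have "orient A B = 1" by (simp add: orient_def)
    with True show ?thesis
      by (simp add: interval_integral_Icc closed_segment_eq_real_ivl)
  next
    case False
    then have "0 \<le> sin (\<alpha> - \<beta>)"
      using le by (intro sin_ge_zero) auto
    then have "sin (\<beta> - \<alpha>) \<le> 0"
      by (simp add: sin_diff algebra_simps)
    then have "signed_area A B \<le> 0"
      unfolding eq by (simp add: mult_nonneg_nonpos)
    with C have "orient A B = -1" by (simp add: orient_def)
    with False show ?thesis
      by (subst interval_integral_endpoints_reverse)
        (simp add: interval_integral_Icc closed_segment_eq_real_ivl)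
  qed
qed

theorem edge_moment_eq_oriented_angular_integral:
  assumes "polar_angle A \<alpha>" "polar_angle B \<beta>" "\<bar>\<beta> - \<alpha>\<bar> \<le> pi"
  shows "edge_moment n m A B = of_real (orient A B) * of_real (zernike_norm n) *
    (LINT \<theta>:closed_segment \<alpha> \<beta>|lborel. angular_integrand n m A B \<theta>)"
proof (cases "signed_area A B = 0")
  case True
  then show ?thesis by (simp add: edge_moment_degenerate orient_def)
next
  case False
  then show ?thesis
    by (simp add: edge_moment_eq_angular_integral[OF assms] angular_integral_orient[OF assms False])
qed

text \<open>The inner \<open>orient\<close> replaces C by |C| in the integrand, and the outer one
  restores the sign; their product is 1 for a nondegenerate edge.\<close>

theorem edge_moment_eq_oriented_integral_zernike_A:
  "edge_moment n m A B = of_real (orient A B) * of_real (zernike_norm n) *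
    (LBINT t=ereal (-1)..ereal 1. of_real (orient A B) * zernike_A n m A B t)"
proof (cases "signed_area A B = 0")
  case True
  then show ?thesis by (simp add: edge_moment_degenerate orient_def)
next
  case False
  then have "complex_of_real (orient A B) * of_real (orient A B) = 1"
    by (simp add: orient_def sgn_if)
  then show ?thesis
    by (simp add: edge_moment_eq_integral_zernike_A)
qed

subsection \<open>Winding numbers of polygonal contours\<close>

abbreviation origin_triangle :: "complex \<Rightarrow> complex \<Rightarrow> complex set" where
  "origin_triangle A B \<equiv> convex hull {0, A, B}"

abbreviation origin_triangle_sides :: "complex \<Rightarrow> complex \<Rightarrow> complex set" where
  "origin_triangle_sides A B \<equiv> closed_segment 0 A \<union> closed_segment A B \<union> closed_segment B 0"

section \<open>Winding numbers of triangles and single edges\<close>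

lemma interior_origin_triangle_degenerate:
  assumes "signed_area A B = 0"
  shows "interior (origin_triangle A B) = {}"
proof -
  obtain w where "w \<noteq> 0" and w: "w \<bullet> A = 0" "w \<bullet> B = 0"
  proof -
    \<comment> \<open>Multiplication by \<open>\<i>\<close> is a quarter turn, so this normal is
      orthogonal to one vertex, and its inner product with the other is, up to sign, twice the
      vanishing signed area.\<close>
    let ?w = "if A \<noteq> 0 then \<i> * A else if B \<noteq> 0 then \<i> * B else 1"
    show thesis
      by (rule that[of ?w]) (use assms in \<open>auto simp: signed_area_def inner_complex_def algebra_simps\<close>)
  qed
  then have "origin_triangle A B \<subseteq> {z. w \<bullet> z = 0}"
    by (intro hull_minimal convex_hyperplane) auto
  then show ?thesis
    using interior_mono interior_hyperplane[OF \<open>w \<noteq> 0\<close>, of 0] by blast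
qed

lemma winding_number_origin_triangle:
  assumes z: "z \<notin> origin_triangle_sides A B"
  shows "winding_number (linepath 0 A +++ linepath A B +++ linepath B 0) z =
    of_real (orient A B * indicator (origin_triangle A B) z)"
proof (cases "z \<in> origin_triangle A B")
  case False
  have "winding_number (linepath 0 A +++ linepath A B +++ linepath B 0) z = 0"
  proof (rule winding_number_zero_outside[OF _ _ _ False])
    have "closed_segment 0 A \<subseteq> origin_triangle A B" "closed_segment A B \<subseteq> origin_triangle A B"
      "closed_segment B 0 \<subseteq> origin_triangle A B"
      by (intro closed_segment_subset hull_inc convex_convex_hull; simp)+
    then show "path_image (linepath 0 A +++ linepath A B +++ linepath B 0) \<subseteq> origin_triangle A B"
      by (simp add: path_image_join)
  qed auto
  then show ?thesis using False by simp
next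
  case True
  then have int: "z \<in> interior (origin_triangle A B)"
    using z by (subst interior_of_triangle) auto
  then have C: "signed_area A B \<noteq> 0"
    using interior_origin_triangle_degenerate by blast
  obtain u v where uv: "z = u *\<^sub>R A + v *\<^sub>R B" "0 \<le> u" "0 \<le> v" "u + v \<le> 1"
    using True unfolding convex_hull_3_alt by auto
  have "v \<noteq> 0"
  proof
    assume "v = 0"
    then have "z \<in> closed_segment 0 A"
      unfolding closed_segment_def using uv by auto
    with z show False by blast
  qed
  \<comment> \<open>The orientation test of \<open>winding_number_triangle\<close> is thus a
    positive multiple of the signed area: \<open>v\<close> is positive, as \<open>z\<close> is not
    on the side from the origin to \<open>A\<close>.\<close>
  have "Im ((A - 0) * cnj (A - z)) = 2 * v * signed_area A B"
    unfolding uv(1) by (simp add: signed_area_def algebra_simps)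
  then have "0 < Im ((A - 0) * cnj (A - z)) \<longleftrightarrow> 0 < signed_area A B"
    using \<open>v \<noteq> 0\<close> uv(3) by (simp add: zero_less_mult_iff)
  then show ?thesis
    using True C unfolding winding_number_triangle[OF int] by (simp add: orient_def sgn_if)
qed

text \<open>An edge alone is an open path, and its winding number need not be an integer. The
  corrections depend on one endpoint each, which is what lets them telescope.\<close>

lemma winding_number_edge:
  assumes z: "z \<notin> origin_triangle_sides A B"
  shows "winding_number (linepath A B) z = of_real (orient A B * indicator (origin_triangle A B) z)
    + winding_number (linepath 0 B) z - winding_number (linepath 0 A) z"
proof -
  have "winding_number (linepath B 0) z = - winding_number (linepath 0 B) z"
    using winding_number_reversepath[of "linepath 0 B" z] z by (simp add: closed_segment_commute)
  moreover have "winding_number (linepath 0 A +++ linepath A B +++ linepath B 0) z =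
      winding_number (linepath 0 A) z + (winding_number (linepath A B) z + winding_number (linepath B 0) z)"
    using z by (simp add: winding_number_join path_image_join)
  ultimately show ?thesis
    using winding_number_origin_triangle[OF z] by (simp add: algebra_simps)
qed

section \<open>Polygonal paths and closed contours\<close>

lemma polygonal_path_properties:
  assumes "2 \<le> length xs"
  shows "path (polygonal_path xs) \<and> pathstart (polygonal_path xs) = hd xs \<and>
    pathfinish (polygonal_path xs) = last xs \<and>
    path_image (polygonal_path xs) = (\<Union>(a, b)\<in>set (zip xs (tl xs)). closed_segment a b)"
  using assms by (induction xs rule: polygonal_path.induct) (auto simp: path_image_join)

lemma winding_number_polygonal_path:
  assumes "2 \<le> length xs"
    and "\<And>A B. (A, B) \<in> set (zip xs (tl xs)) \<Longrightarrow> z \<notin> origin_triangle_sides A B"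
  shows "winding_number (polygonal_path xs) z =
    (\<Sum>(A, B)\<leftarrow>zip xs (tl xs). of_real (orient A B * indicator (origin_triangle A B) z))
    + winding_number (linepath 0 (last xs)) z - winding_number (linepath 0 (hd xs)) z"
  using assms
proof (induction xs rule: polygonal_path.induct)
  case (3 a b)
  then show ?case by (simp add: winding_number_edge del: linepath_0)
next
  case (4 a b c vs)
  let ?p = "polygonal_path (b # c # vs)"
  have p: "path ?p" "pathstart ?p = b"
    "path_image ?p = (\<Union>(a, b)\<in>set (zip (b # c # vs) (tl (b # c # vs))). closed_segment a b)"
    using polygonal_path_properties[of "b # c # vs"] by auto
  have z: "z \<notin> origin_triangle_sides a b" using 4(3)[of a b] by simp
  have sub: "z \<notin> origin_triangle_sides A B" if "(A, B) \<in> set (zip (b # c # vs) (tl (b # c # vs)))" for A B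
    using 4(3)[of A B] that by simp
  have "z \<notin> path_image ?p"
    unfolding p(3) using sub by blast
  then have "winding_number (polygonal_path (a # b # c # vs)) z =
      winding_number (linepath a b) z + winding_number ?p z"
    using z p by (simp add: winding_number_join)
  also have "winding_number ?p z =
    (\<Sum>(A, B)\<leftarrow>zip (b # c # vs) (tl (b # c # vs)). of_real (orient A B * indicator (origin_triangle A B) z))
    + winding_number (linepath 0 (last (b # c # vs))) z - winding_number (linepath 0 (hd (b # c # vs))) z"
    by (rule 4(1)) (use sub in auto)
  finally show ?case
    by (simp add: winding_number_edge[OF z] del: linepath_0)
qed auto

lemma zip_tl_closed_eq_contour_edges:
  assumes "vs \<noteq> []"
  shows "zip (vs @ [hd vs]) (tl (vs @ [hd vs])) = contour_edges vs"
  using assms zip_append1[of vs "[hd vs]" "tl (vs @ [hd vs])"]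
  by (cases vs) (simp_all add: contour_edges_def)

lemma
  assumes "vs \<noteq> []"
  shows path_contour_path: "path (contour_path vs)"
    and contour_path_closed: "pathfinish (contour_path vs) = pathstart (contour_path vs)"
    and contour_image_eq: "contour_image vs = (\<Union>(a, b)\<in>set (contour_edges vs). closed_segment a b)"
proof -
  have "2 \<le> length (vs @ [hd vs])" using assms by (cases vs) auto
  from polygonal_path_properties[OF this]
  show "path (contour_path vs)" "pathfinish (contour_path vs) = pathstart (contour_path vs)"
    "contour_image vs = (\<Union>(a, b)\<in>set (contour_edges vs). closed_segment a b)"
    using assms unfolding contour_path_def zip_tl_closed_eq_contour_edges[OF assms] by simp_all
qed

text \<open>The contributions of the rays from the origin to the vertices telescope around a closed contour.\<close>

lemma winding_number_contour_path:
  assumes "vs \<noteq> []"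
    and "\<And>A B. (A, B) \<in> set (contour_edges vs) \<Longrightarrow> z \<notin> origin_triangle_sides A B"
  shows "winding_number (contour_path vs) z =
    (\<Sum>(A, B)\<leftarrow>contour_edges vs. of_real (orient A B * indicator (origin_triangle A B) z))"
proof -
  have "2 \<le> length (vs @ [hd vs])" using assms(1) by (cases vs) auto
  from winding_number_polygonal_path[OF this, of z] assms show ?thesis
    unfolding contour_path_def zip_tl_closed_eq_contour_edges[OF assms(1)] by simp
qed

section \<open>Winding numbers around a domain with holes\<close>

lemma outside_subset_outside:
  fixes S T :: "'a::euclidean_space set"
  assumes "bounded S" "2 \<le> DIM('a)" "T \<inter> outside S = {}"
  shows "outside S \<subseteq> outside T"
proof
  fix z assume z: "z \<in> outside S"
  \<comment> \<open>In dimension at least 2 the outside of a bounded set is connected and unbounded.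
    Since it avoids \<open>T\<close>, it lies in one component of the complement of
    \<open>T\<close>, which is therefore unbounded.\<close>
  have "outside S \<subseteq> connected_component_set (- T) z"
    using assms z by (intro connected_component_maximal connected_outside) auto
  then have "\<not> bounded (connected_component_set (- T) z)"
    using unbounded_outside[OF assms(1)] bounded_subset by blast
  then show "z \<in> outside T"
    by (simp add: outside)
qed

text \<open>Inside the outer contour, a point off the contours is either in \<open>D\<close>, with
  all holes contributing 0, or inside exactly one hole, whose -1 cancels the outer 1. Outside the
  outer contour it must be shown that no hole extends there.\<close>

lemma polygonal_domain_winding_number:
  assumes D: "polygonal_domain D outer holes"
    and z: "z \<notin> contour_image outer" "\<And>h. h \<in> set holes \<Longrightarrow> z \<notin> contour_image h"
  shows "indicator D z = winding_number (contour_path outer) z +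
    (\<Sum>h\<leftarrow>holes. winding_number (contour_path h) z)"
proof -
  have simple: "outer \<noteq> []" "\<And>h. h \<in> set holes \<Longrightarrow> h \<noteq> []"
    using D by (fastforce simp: polygonal_domain_def simple_contour_def)+
  have Deq: "D = inside (contour_image outer) \<inter> (\<Inter>h \<in> set holes. outside (contour_image h))"
    and fr: "frontier D = contour_image outer \<union> (\<Union>h \<in> set holes. contour_image h)"
    using D unfolding polygonal_domain_def by blast+
  have disj: "inside (contour_image (holes ! i)) \<inter> inside (contour_image (holes ! j)) = {}"
    if "i \<noteq> j" "i < length holes" "j < length holes" for i j
    using D that unfolding polygonal_domain_def by (metis Int_commute linorder_neqE_nat)
  have out0: "winding_number (contour_path vs) z = 0"
    if "vs \<noteq> []" "z \<in> outside (contour_image vs)" for vs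
    using that by (intro winding_number_zero_in_outside path_contour_path contour_path_closed)
  have in1: "winding_number (contour_path outer) z = 1" if "z \<in> inside (contour_image outer)"
    using D that by (simp add: polygonal_domain_def counterclockwise_def)
  have hole: "winding_number (contour_path h) z = -1"
    if "h \<in> set holes" "z \<in> inside (contour_image h)" for h
    using D that by (simp add: polygonal_domain_def clockwise_def)
  have holes0: "(\<Sum>h\<leftarrow>holes. winding_number (contour_path h) z) = 0"
    if "\<And>h. h \<in> set holes \<Longrightarrow> z \<in> outside (contour_image h)"
  proof -
    have "map (\<lambda>h. winding_number (contour_path h) z) holes = map (\<lambda>_. 0) holes"
      using that out0 simple by (intro map_cong) auto
    then have "(\<Sum>h\<leftarrow>holes. winding_number (contour_path h) z) = (\<Sum>h\<leftarrow>holes. 0)"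
      by (rule arg_cong)
    also have "\<dots> = 0" by simp
    finally show ?thesis .
  qed
  have bdd: "bounded (contour_image outer)" and cl: "closed (contour_image outer)"
    using path_contour_path[OF simple(1)] by (auto intro: bounded_path_image closed_path_image)
  show ?thesis
  proof (cases "z \<in> inside (contour_image outer)")
    case False
    then have zout: "z \<in> outside (contour_image outer)"
      using z(1) inside_Un_outside[of "contour_image outer"] by blast
    \<comment> \<open>Every hole contour lies in the frontier, hence in the closure, of
      \<open>D\<close>. As the outside of the outer contour is open and disjoint from
      \<open>D\<close>, no hole contour reaches it.\<close>
    have "closure D \<subseteq> - outside (contour_image outer)"
    proof (rule closure_minimal)
      show "D \<subseteq> - outside (contour_image outer)"
        using Deq inside_Int_outside by blast
      show "closed (- outside (contour_image outer))"
        using open_outside[OF cl] by (rule closed_Compl)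
    qed
    then have "contour_image h \<inter> outside (contour_image outer) = {}" if "h \<in> set holes" for h
      using that fr by (auto simp: frontier_def)
    then have "outside (contour_image outer) \<subseteq> outside (contour_image h)" if "h \<in> set holes" for h
      using that by (intro outside_subset_outside[OF bdd]) simp_all
    then have "(\<Sum>h\<leftarrow>holes. winding_number (contour_path h) z) = 0"
      using zout by (intro holes0) blast
    moreover have "z \<notin> D" using False Deq by blast
    ultimately show ?thesis
      using out0[OF simple(1) zout] by simp
  next
    case True
    show ?thesis
    proof (cases "z \<in> D")
      case True
      then have "z \<in> inside (contour_image outer)" "\<And>h. h \<in> set holes \<Longrightarrow> z \<in> outside (contour_image h)"
        using Deq by blast+
      with True show ?thesis
        by (simp only: in1 holes0 indicator_simps add_0_right)
    next
      case False
      with True obtain h where "h \<in> set holes" "z \<notin> outside (contour_image h)"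
        using Deq by blast
      moreover from this have "z \<in> inside (contour_image h)"
        using z(2) inside_Un_outside[of "contour_image h"] by blast
      ultimately obtain i where i: "i < length holes" "z \<in> inside (contour_image (holes ! i))"
        unfolding in_set_conv_nth by blast
      \<comment> \<open>Holes are compared by position in the list, the form in which disjointness
        of their insides is given.\<close>
      have "winding_number (contour_path (holes ! j)) z = (if j = i then -1 else 0)"
        if "j < length holes" for j
      proof (cases "j = i")
        case True
        then show ?thesis using i hole by simp
      next
        case False
        then have "z \<notin> inside (contour_image (holes ! j))"
          using disj[of j i] that i by blast
        then have "z \<in> outside (contour_image (holes ! j))"
          using z(2)[OF nth_mem[OF that]] inside_Un_outside[of "contour_image (holes ! j)"] by blast
        then show ?thesis using False out0 simple(2)[OF nth_mem[OF that]] by simp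
      qed
      then have "(\<Sum>h\<leftarrow>holes. winding_number (contour_path h) z) =
          (\<Sum>j = 0..<length holes. if j = i then -1 else 0)"
        by (simp add: sum_list_sum_nth)
      also have "\<dots> = -1" using i by simp
      finally show ?thesis using in1[OF True] False by simp
    qed
  qed
qed

section \<open>From indicator functions to moments\<close>

lemma sum_list_concat_map: "(\<Sum>x\<leftarrow>xs. \<Sum>y\<leftarrow>g x. f y) = (\<Sum>y\<leftarrow>concat (map g xs). f y)"
  by (induction xs) simp_all

lemma polygonal_domain_indicator:
  assumes D: "polygonal_domain D outer holes"
    and z: "\<And>A B. (A, B) \<in> set (boundary_edges outer holes) \<Longrightarrow> z \<notin> origin_triangle_sides A B"
  shows "indicator D z =
    (\<Sum>(A, B)\<leftarrow>boundary_edges outer holes. of_real (orient A B * indicator (origin_triangle A B) z) :: complex)"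
proof -
  have edges: "set (contour_edges vs) \<subseteq> set (boundary_edges outer holes)" if "vs \<in> set (outer # holes)" for vs
    using that by (auto simp: boundary_edges_def)
  have nonempty: "vs \<noteq> []" if "vs \<in> set (outer # holes)" for vs
    using D that by (fastforce simp: polygonal_domain_def simple_contour_def)
  have image: "z \<notin> contour_image vs" if "vs \<in> set (outer # holes)" for vs
    using z edges[OF that] unfolding contour_image_eq[OF nonempty[OF that]] by fastforce
  let ?f = "\<lambda>(A, B). of_real (orient A B * indicator (origin_triangle A B) z) :: complex"
  have wind: "winding_number (contour_path vs) z = (\<Sum>e\<leftarrow>contour_edges vs. ?f e)"
    if "vs \<in> set (outer # holes)" for vs
    using z edges[OF that] by (intro winding_number_contour_path nonempty[OF that]) blast
  have "indicator D z = (\<Sum>vs\<leftarrow>outer # holes. winding_number (contour_path vs) z)"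
    using polygonal_domain_winding_number[OF D, of z] image by simp
  also have "\<dots> = (\<Sum>vs\<leftarrow>outer # holes. \<Sum>e\<leftarrow>contour_edges vs. ?f e)"
    using wind by (intro arg_cong[where f = sum_list] map_cong) auto
  also have "\<dots> = (\<Sum>e\<leftarrow>boundary_edges outer holes. ?f e)"
    unfolding boundary_edges_def by (rule sum_list_concat_map)
  finally show ?thesis .
qed

lemma null_sets_closed_segment: "closed_segment a b \<in> null_sets lborel" for a b :: complex
proof -
  have "negligible (closed_segment a b)"
    by (simp add: negligible_convex_interior interior_closed_segment_ge2)
  then show ?thesis
    by (simp add: negligible_iff_null_sets null_sets_completion_iff)
qed

lemma has_bochner_integral_sum_list:
  assumes "\<And>e. e \<in> set es \<Longrightarrow> has_bochner_integral M (f e) (I e)"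
  shows "has_bochner_integral M (\<lambda>x. \<Sum>e\<leftarrow>es. f e x) (\<Sum>e\<leftarrow>es. I e)"
  using assms by (induction es) (auto intro: has_bochner_integral_add)

theorem zernike_moment_eq_sum_edge_moments:
  assumes D: "polygonal_domain D outer holes"
  shows "zernike_moment n m D = (\<Sum>(A, B)\<leftarrow>boundary_edges outer holes. edge_moment n m A B)"
proof -
  let ?E = "boundary_edges outer holes" and ?f = "\<lambda>z. cnj (zernike_V n m z)"
  let ?g = "\<lambda>(A, B) z. of_real (orient A B) * (indicator (origin_triangle A B) z *\<^sub>R ?f z)"
  have "open D"
    using D unfolding polygonal_domain_def by blast
  then have [measurable]: "D \<in> sets borel"
    by (rule borel_open)
  have int: "has_bochner_integral lborel (?g e) (case e of (A, B) \<Rightarrow> edge_moment n m A B)" for e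
  proof (cases e)
    case (Pair A B)
    have "origin_triangle A B \<in> sets borel"
      by (intro borel_closed compact_imp_closed compact_convex_hull finite_imp_compact) auto
    then have "integrable lborel (\<lambda>z. indicator (origin_triangle A B) z *\<^sub>R ?f z)"
      using set_integrable_cnj_zernike_V[of "origin_triangle A B" n m]
      by (simp add: set_integrable_def finite_imp_bounded bounded_convex_hull)
    from has_bochner_integral_mult_right[OF has_bochner_integral_integrable[OF this]] show ?thesis
      unfolding Pair prod.case edge_moment_def set_lebesgue_integral_def .
  qed
  have sum: "has_bochner_integral lborel (\<lambda>z. \<Sum>e\<leftarrow>?E. ?g e z)
      (\<Sum>(A, B)\<leftarrow>?E. edge_moment n m A B)"
    by (rule has_bochner_integral_sum_list) (rule int)
  \<comment> \<open>Besides the edges, the exceptional set contains the segments from the origin to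
    the vertices: there adjacent closed triangles overlap, and the signed count of triangles can
    fail even off the contours.\<close>
  let ?N = "\<Union>(A, B)\<in>set ?E. origin_triangle_sides A B"
  have "?N \<in> null_sets lborel"
    by (intro null_sets_UN' countable_finite) (auto intro!: null_sets.Un null_sets_closed_segment)
  then have "AE z in lborel. z \<notin> ?N"
    by (rule AE_not_in)
  then have ae: "AE z in lborel. indicator D z *\<^sub>R ?f z = (\<Sum>e\<leftarrow>?E. ?g e z)"
  proof eventually_elim
    case (elim z)
    then have "indicator D z =
        (\<Sum>(A, B)\<leftarrow>?E. of_real (orient A B * indicator (origin_triangle A B) z) :: complex)"
      by (intro polygonal_domain_indicator[OF D]) blast
    then have "of_real (indicator D z) * ?f z =
        (\<Sum>(A, B)\<leftarrow>?E. of_real (orient A B * indicator (origin_triangle A B) z)) * ?f z"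
      by (simp only: of_real_indicator)
    also have "\<dots> = (\<Sum>e\<leftarrow>?E. ?g e z)"
      by (simp add: sum_list_mult_const[symmetric] case_prod_unfold scaleR_conv_of_real mult.assoc)
    finally show ?case by (simp only: scaleR_conv_of_real)
  qed
  have "zernike_moment n m D = (LINT z|lborel. indicator D z *\<^sub>R ?f z)"
    by (simp add: zernike_moment_def set_lebesgue_integral_def)
  also have "\<dots> = (LINT z|lborel. (\<Sum>e\<leftarrow>?E. ?g e z))"
    by (rule integral_cong_AE[OF _ _ ae]) (use sum in \<open>auto simp: has_bochner_integral_iff\<close>)
  also have "\<dots> = (\<Sum>(A, B)\<leftarrow>?E. edge_moment n m A B)"
    using sum by (simp add: has_bochner_integral_iff)
  finally show ?thesis .
qed

theorem mainTheorem3: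
  fixes D :: "complex set" and outer :: "complex list" and holes :: "complex list list"
    and n :: nat and m :: int
  assumes "polygonal_domain D outer holes"
    and "D \<subseteq> cball 0 1"
    and "\<bar>m\<bar> \<le> int n"
    and "even (int n - \<bar>m\<bar>)"
  shows "zernike_moment n m D = (\<Sum>(A, B) \<leftarrow> boundary_edges outer holes. edge_moment n m A B)
    \<and> (\<forall>(A, B) \<in> set (boundary_edges outer holes).
         (\<forall>\<theta>\<^sub>A \<theta>\<^sub>B. polar_angle A \<theta>\<^sub>A \<and> polar_angle B \<theta>\<^sub>B \<and> \<bar>\<theta>\<^sub>B - \<theta>\<^sub>A\<bar> \<le> pi \<longrightarrow>
            edge_moment n m A B = of_real (zernike_norm n) *
              (LBINT \<theta>=ereal \<theta>\<^sub>A..ereal \<theta>\<^sub>B. angular_integrand n m A B \<theta>) \<and>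
            edge_moment n m A B = of_real (orient A B) * of_real (zernike_norm n) *
              (LINT \<theta>:closed_segment \<theta>\<^sub>A \<theta>\<^sub>B|lborel. angular_integrand n m A B \<theta>)) \<and>
         edge_moment n m A B = of_real (zernike_norm n) *
           (LBINT t=ereal (-1)..ereal 1. zernike_A n m A B t) \<and>
         edge_moment n m A B = of_real (orient A B) * of_real (zernike_norm n) *
           (LBINT t=ereal (-1)..ereal 1. of_real (orient A B) * zernike_A n m A B t))"
proof (intro conjI ballI)
  fix e assume "e \<in> set (boundary_edges outer holes)"
  obtain A B where e: "e = (A, B)" by (cases e)
  show "case e of (A, B) \<Rightarrow>
         (\<forall>\<theta>\<^sub>A \<theta>\<^sub>B. polar_angle A \<theta>\<^sub>A \<and> polar_angle B \<theta>\<^sub>B \<and> \<bar>\<theta>\<^sub>B - \<theta>\<^sub>A\<bar> \<le> pi \<longrightarrow>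
            edge_moment n m A B = of_real (zernike_norm n) *
              (LBINT \<theta>=ereal \<theta>\<^sub>A..ereal \<theta>\<^sub>B. angular_integrand n m A B \<theta>) \<and>
            edge_moment n m A B = of_real (orient A B) * of_real (zernike_norm n) *
              (LINT \<theta>:closed_segment \<theta>\<^sub>A \<theta>\<^sub>B|lborel. angular_integrand n m A B \<theta>)) \<and>
         edge_moment n m A B = of_real (zernike_norm n) *
           (LBINT t=ereal (-1)..ereal 1. zernike_A n m A B t) \<and>
         edge_moment n m A B = of_real (orient A B) * of_real (zernike_norm n) *
           (LBINT t=ereal (-1)..ereal 1. of_real (orient A B) * zernike_A n m A B t)"
    unfolding e prod.case
    by (intro conjI allI impI edge_moment_eq_angular_integral edge_moment_eq_oriented_angular_integral
        edge_moment_eq_integral_zernike_A edge_moment_eq_oriented_integral_zernike_A) auto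
qed (rule zernike_moment_eq_sum_edge_moments[OF assms(1)])

end
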